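(* Let $\alpha$ be a countable nonzero ordinal and let $k$, $m$ and $n$ be positive integers. \begin{enumerate} \item $R^{top}(\omega^{\omega^\alpha},k+1)=R^{cl}(\omega^{\omega^\alpha},k+1)\leq\omega^{\omega^{\alpha\cdot k}}$. \item $R^{top}(\omega^{\omega^\alpha}+1,k+1)=R^{cl}(\omega^{\omega^\alpha}+1,k+1)$, and this ordinal is at most $\omega^{\omega^{\alpha\cdot k}}+1$ if $\alpha$ is infinite, and at most $\omega^{\omega^{(n+1)\cdot k-1}}+1$ if $\alpha=n$ is finite. \item $R^{top}(\omega^n\cdot m+1,k+2)=R^{cl}(\omega^n\cdot m+1,k+2)\leq\omega^{\omega^k\cdot n}\cdot R(m,k+2)+1$. \end{enumerate}
   Context: All arithmetic operations on ordinals are in the ordinal sense. Every ordinal is identified with the set of smaller ordinals and carries the order topology; subsets carry the subspace topology. A set $X$ of ordinals is order-homeomorphic to an ordinal $\alpha$ (a closed copy of $\alpha$) if there is a bijection $X\to\alpha$ that is both an order-isomorphism and a homeomorphism; equivalently, $X$ is order-isomorphic to $\alpha$ and closed in its supremum. $[X]^2$ is the set of $2$-element subsets of $X$. $R^{top}(\alpha,k)$ (respectively $R^{cl}(\alpha,k)$, $R(\alpha,k)$) is the least ordinal $\beta$ such that for every coloring $c:[\beta]^2\to\{\text{red},\text{blue}\}$ either there is $X\subseteq\beta$ homeomorphic (respectively order-homeomorphic, order-isomorphic) to $\alpha$ with all elements of $[X]^2$ red, or there is a $k$-element $Y\subseteq\beta$ with all elements of $[Y]^2$ blue; for finite $m$,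 $R(m,k)$ is the usual finite Ramsey number. *)

theory Defs
  imports "HOL-Analysis.Analysis" "HOL-Library.Ramsey" "HOL-Library.Infinite_Typeclass"
begin

unbundle cardinal_syntax

section \<open>Ordinals\<close>

text \<open>
  No single HOL type contains all ordinals, so the type of ordinals has a parameter.  For an
  infinite type \<open>'a\<close> of cardinality \<open>\<kappa>\<close>, \<open>'a ordinal\<close> is the well-order \<open>\<kappa>\<^sup>+\<close>: its elements are the
  ordinals of cardinality at most \<open>\<kappa>\<close>, see \<open>card_of_lessThan_ordinal\<close> and \<open>ex_order_type\<close>.
  In particular all countable ordinals are present for every infinite \<open>'a\<close>.  An ordinal \<open>\<alpha>\<close>, as a
  set of smaller ordinals, is \<open>{..<\<alpha>}\<close>.  For finite \<open>'a\<close> the type is a finite linear order,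
  without ordinal arithmetic.
\<close>

typedef 'a ordinal = "Field (cardSuc |UNIV :: 'a set| )"
  using Field_cardSuc_not_empty[OF card_of_Card_order] by blast

setup_lifting type_definition_ordinal

lemma wo_rel_cardSuc: "wo_rel (cardSuc |A| )"
  by (simp add: wo_rel_def cardSuc_Well_order card_of_Card_order)

instantiation ordinal :: (type) wellorder
begin

lift_definition less_eq_ordinal :: "'a ordinal \<Rightarrow> 'a ordinal \<Rightarrow> bool"
  is "\<lambda>x y. (x, y) \<in> cardSuc |UNIV :: 'a set|" .

definition less_ordinal :: "'a ordinal \<Rightarrow> 'a ordinal \<Rightarrow> bool"
  where "less_ordinal x y \<longleftrightarrow> x \<le> y \<and> x \<noteq> y"

instance
proof
  fix x y z :: "'a ordinal"
  note wo = wo_rel_cardSuc[of "UNIV :: 'a set"]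
  show refl: "x \<le> x"
    using wo_rel.REFL[OF wo] by transfer (auto simp: refl_on_def)
  show trans: "x \<le> z" if "x \<le> y" "y \<le> z"
    using that wo_rel.TRANS[OF wo] by transfer (meson transD)
  show antisym: "x = y" if "x \<le> y" "y \<le> x"
    using that wo_rel.ANTISYM[OF wo] by transfer (meson antisymD)
  show "x \<le> y \<or> y \<le> x"
    using wo_rel.TOTALS[OF wo] by transfer blast
  show "x < y \<longleftrightarrow> x \<le> y \<and> \<not> y \<le> x"
    using refl antisym by (auto simp: less_ordinal_def)
  show "P x" if "\<And>x. (\<And>y. y < x \<Longrightarrow> P y) \<Longrightarrow> P x" for P and x :: "'a ordinal"
  proof -
    have "wf (cardSuc |UNIV :: 'a set| - Id)"
      by (rule wo_rel.WF[OF wo])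
    then have "wf (inv_image (cardSuc |UNIV :: 'a set| - Id) Rep_ordinal)"
      by (rule wf_inv_image)
    also have "inv_image (cardSuc |UNIV :: 'a set| - Id) Rep_ordinal = {(x, y). x < y}"
      by (auto simp: inv_image_def less_ordinal_def less_eq_ordinal.rep_eq Rep_ordinal_inject)
    finally show ?thesis
      using that by (induction x rule: wf_induct_rule) auto
  qed
qed

end

text \<open>
  The type carries the order topology.  Since \<open>{..<\<alpha>}\<close> is an initial segment, its subspace topology
  is the order topology of the ordinal \<open>\<alpha>\<close>; see \<open>top_of_set_lessThan_ordinal\<close>.
\<close>

instantiation ordinal :: (type) linorder_topology
begin

definition open_ordinal :: "'a ordinal set \<Rightarrow> bool"
  where "open_ordinal = generate_topology (range (\<lambda>a. {..<a}) \<union> range (\<lambda>a. {a<..}))"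

instance
  by standard (rule open_ordinal_def)

end

lemma top_of_set_lessThan_ordinal:
  fixes \<alpha> :: "'a ordinal"
  defines "\<R> \<equiv> (\<lambda>a. {..<a}) ` {..<\<alpha>} \<union> (\<lambda>a. {a<..<\<alpha>}) ` {..<\<alpha>}"
  shows "top_of_set {..<\<alpha>} = topology_generated_by (insert {..<\<alpha>} \<R>)"
proof -
  let ?G = "topology_generated_by (insert {..<\<alpha>} \<R>)"
  have top: "topspace ?G = {..<\<alpha>}"
    by (auto simp: topology_generated_by_topspace \<R>_def)
  have "openin ?G ({..<\<alpha>} \<inter> T)" if "open T" for T
    using that unfolding open_generated_order
  proof (induction rule: generate_topology.induct)
    case UNIV
    then show ?case
      by (metis top Int_UNIV_right openin_topspace)
  next
    case (Int A B)
    then have "openin ?G (({..<\<alpha>} \<inter> A) \<inter> ({..<\<alpha>} \<inter> B))"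
      by blast
    then show ?case
      by (simp add: Int_ac)
  next
    case (UN K)
    then have "openin ?G (\<Union>k\<in>K. {..<\<alpha>} \<inter> k)"
      by blast
    then show ?case
      by (simp only: Int_Union)
  next
    case (Basis S)
    then obtain a where "S = {..<a} \<or> S = {a<..}"
      by auto
    then have "{..<\<alpha>} \<inter> S = {} \<or> {..<\<alpha>} \<inter> S \<in> insert {..<\<alpha>} \<R>"
    proof (cases "a < \<alpha>")
      case True
      then have "{..<\<alpha>} \<inter> {..<a} = {..<a}" "{..<\<alpha>} \<inter> {a<..} = {a<..<\<alpha>}"
        by auto
      then show ?thesis
        using \<open>S = {..<a} \<or> S = {a<..}\<close> True unfolding \<R>_def by blast
    next
      case False
      then have "{..<\<alpha>} \<inter> {..<a} = {..<\<alpha>}" "{..<\<alpha>} \<inter> {a<..} = {}"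
        by auto
      then show ?thesis
        using \<open>S = {..<a} \<or> S = {a<..}\<close> by (elim disjE) simp_all
    qed
    then show ?case
      by (elim disjE) (simp, erule topology_generated_by_Basis)
  qed
  moreover have "openin (top_of_set {..<\<alpha>}) U" if "openin ?G U" for U
  proof -
    have "generate_topology_on (insert {..<\<alpha>} \<R>) U"
      using that by (rule openin_topology_generated_by)
    then show ?thesis
    proof (induction rule: generate_topology_on.induct)
      case (Basis S)
      have "S = {..<\<alpha>} \<inter> S" "open S"
        using Basis by (auto simp: \<R>_def)
      then show ?case
        unfolding openin_open by blast
    qed auto
  qed
  ultimately show ?thesis
    by (metis topology_eq openin_open)
qed

lemma image_Rep_ordinal_lessThan:
  "Rep_ordinal ` {..<\<alpha>} = underS (cardSuc |UNIV :: 'a set| ) (Rep_ordinal (\<alpha> :: 'a ordinal))"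
proof -
  have "x \<in> Rep_ordinal ` {..<\<alpha>}" if "x \<in> underS (cardSuc |UNIV| ) (Rep_ordinal \<alpha>)" for x
  proof -
    have "x \<in> Field (cardSuc |UNIV :: 'a set| )"
      using that by (auto simp: underS_def intro: FieldI1)
    then obtain y where "x = Rep_ordinal y"
      by (metis Rep_ordinal_cases)
    then show ?thesis
      using that by (auto simp: underS_def less_ordinal_def less_eq_ordinal.rep_eq)
  qed
  then show ?thesis
    by (auto simp: underS_def less_ordinal_def less_eq_ordinal.rep_eq Rep_ordinal_inject)
qed

lemma card_of_lessThan_ordinal: "|{..<\<alpha> :: 'a ordinal}| \<le>o |UNIV :: 'a set|"
proof -
  let ?r = "cardSuc |UNIV :: 'a set|"
  have "|underS ?r (Rep_ordinal \<alpha>)| <o ?r"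
    by (rule card_of_underS[OF cardSuc_Card_order[OF card_of_Card_order] Rep_ordinal])
  moreover have "Rep_ordinal ` {..<\<alpha>} = underS ?r (Rep_ordinal \<alpha>)"
    by (rule image_Rep_ordinal_lessThan)
  moreover have "|{..<\<alpha>}| =o |Rep_ordinal ` {..<\<alpha>}|"
    by (meson Rep_ordinal_inject card_of_ordIsoI inj_on_imp_bij_betw inj_onI)
  ultimately have "|{..<\<alpha>}| <o ?r"
    by (metis ordIso_ordLess_trans)
  then show ?thesis
    using cardSuc_ordLeq_ordLess[OF card_of_Card_order card_of_Card_order] by blast
qed

lemma ex_order_type:
  assumes "Well_order r" "|Field r| \<le>o |UNIV :: 'a set|"
  obtains \<alpha> :: "'a ordinal" and f
  where "bij_betw f (Field r) {..<\<alpha>}"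
    and "\<And>x y. x \<in> Field r \<Longrightarrow> y \<in> Field r \<Longrightarrow> (x, y) \<in> r \<longleftrightarrow> f x \<le> f y"
proof -
  let ?s = "cardSuc |UNIV :: 'a set|"
  have s: "Well_order ?s" and co: "Card_order ?s"
    by (simp_all add: cardSuc_Well_order cardSuc_Card_order card_of_Card_order)
  have "r <o ?s"
  proof (rule ccontr)
    assume "\<not> r <o ?s"
    then have "?s \<le>o r"
      using assms(1) s not_ordLess_iff_ordLeq by blast
    then have "|Field ?s| \<le>o |Field r|"
      by (rule card_of_mono2)
    then have "?s \<le>o |UNIV :: 'a set|"
      using assms(2) card_of_Field_ordIso[OF co] ordIso_symmetric ordIso_ordLeq_trans ordLeq_transitive
      by blast
    then show False
      using cardSuc_greater[OF card_of_Card_order] not_ordLess_ordLeq by blast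
  qed
  then obtain a where a: "a \<in> Field ?s" "r =o Restr ?s (underS ?s a)"
    using ordLess_iff_ordIso_Restr[OF s assms(1)] by blast
  define \<alpha> where "\<alpha> = Abs_ordinal a"
  have a_eq: "a = Rep_ordinal \<alpha>"
    using a(1) by (simp add: \<alpha>_def Abs_ordinal_inverse)
  have field: "Field (Restr ?s (underS ?s a)) = underS ?s a"
    by (rule Field_Restr_ofilter[OF s wo_rel.underS_ofilter[OF wo_rel_cardSuc]])
  obtain g where g: "iso r (Restr ?s (underS ?s a)) g"
    using a(2) by (auto simp: ordIso_def)
  have bij: "bij_betw g (Field r) (underS ?s a)"
    using g unfolding iso_def field by blast
  have ord: "(x, y) \<in> r \<longleftrightarrow> (g x, g y) \<in> ?s" if "x \<in> Field r" "y \<in> Field r" for x y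
  proof -
    have "(x, y) \<in> r \<longleftrightarrow> (g x, g y) \<in> Restr ?s (underS ?s a)"
      using g that unfolding iso_iff2 by blast
    moreover have "g x \<in> underS ?s a" "g y \<in> underS ?s a"
      using that bij bij_betwE by blast+
    ultimately show ?thesis
      by blast
  qed
  have img: "underS ?s a = Rep_ordinal ` {..<\<alpha>}"
    by (simp add: image_Rep_ordinal_lessThan a_eq)
  have Rep: "Rep_ordinal (Abs_ordinal (g x)) = g x" if "x \<in> Field r" for x
    using that bij_betwE[OF bij] by (auto simp: img Rep_ordinal_inverse)
  have "bij_betw Abs_ordinal (underS ?s a) {..<\<alpha>}"
    unfolding img by (rule bij_betw_byWitness[where f' = Rep_ordinal]) (auto simp: Rep_ordinal_inverse)
  from bij_betw_trans[OF bij this] show thesis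
    by (rule that) (simp add: less_eq_ordinal.rep_eq ord Rep)
qed

lemma bounded_ordinal:
  fixes S :: "'a::infinite ordinal set"
  assumes "|S| \<le>o |UNIV :: 'a set|"
  obtains \<beta> where "\<And>\<alpha>. \<alpha> \<in> S \<Longrightarrow> \<alpha> < \<beta>"
proof -
  let ?r = "|UNIV :: 'a set|"
  have co: "Card_order (cardSuc ?r)"
    by (simp add: cardSuc_Card_order card_of_Card_order)
  have inf: "infinite (Field (cardSuc ?r))"
    using card_of_cardSuc_finite[of "UNIV :: 'a set"] infinite_UNIV by simp
  have "\<exists>i\<in>Field (cardSuc ?r). Rep_ordinal ` S \<subseteq> underS (cardSuc ?r) i"
  proof (rule cardSuc_UNION)
    show "Card_order ?r"
      by (rule card_of_Card_order)
    show "infinite (Field ?r)"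
      by (simp add: Field_card_of infinite_UNIV)
    show "relChain (cardSuc ?r) (underS (cardSuc ?r))"
      unfolding relChain_def
    proof (intro allI impI)
      fix i j
      assume ij: "(i, j) \<in> cardSuc ?r"
      then have "i \<in> Field (cardSuc ?r)" "j \<in> Field (cardSuc ?r)"
        by (auto intro: FieldI1 FieldI2)
      then show "underS (cardSuc ?r) i \<subseteq> underS (cardSuc ?r) j"
        using ij underS_incl_iff[of "cardSuc ?r" i j] wo_rel.LIN[OF wo_rel_cardSuc] by blast
    qed
    show "Rep_ordinal ` S \<subseteq> \<Union> (underS (cardSuc ?r) ` Field (cardSuc ?r))"
    proof
      fix x
      assume "x \<in> Rep_ordinal ` S"
      then have "x \<in> Field (cardSuc ?r)"
        using Rep_ordinal by blast
      then obtain y where "y \<in> Field (cardSuc ?r)" "x \<noteq> y" "(x, y) \<in> cardSuc ?r"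
        using infinite_Card_order_limit[OF co inf] by blast
      then show "x \<in> \<Union> (underS (cardSuc ?r) ` Field (cardSuc ?r))"
        unfolding underS_def by blast
    qed
    show "|Rep_ordinal ` S| \<le>o ?r"
      using card_of_image assms ordLeq_transitive by blast
  qed
  then obtain \<beta> :: "'a ordinal" where "Rep_ordinal ` S \<subseteq> underS (cardSuc ?r) (Rep_ordinal \<beta>)"
    by (metis Rep_ordinal_cases)
  then have "Rep_ordinal ` S \<subseteq> Rep_ordinal ` {..<\<beta>}"
    by (simp only: image_Rep_ordinal_lessThan)
  then have "\<alpha> < \<beta>" if "\<alpha> \<in> S" for \<alpha>
    using that inj_image_mem_iff[of Rep_ordinal \<alpha> "{..<\<beta>}"] by (auto simp: inj_def Rep_ordinal_inject)
  then show thesis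
    by (rule that)
qed

lemma bounded_image_ordinal:
  fixes f :: "'a::infinite ordinal \<Rightarrow> 'a ordinal"
  obtains \<delta> where "\<epsilon> < \<delta>" and "\<And>\<gamma>. \<gamma> < \<beta> \<Longrightarrow> f \<gamma> < \<delta>"
proof -
  have "|f ` {..<\<beta>}| \<le>o |UNIV :: 'a set|"
    using card_of_image card_of_lessThan_ordinal by (rule ordLeq_transitive)
  then obtain \<delta>1 where 1: "\<And>\<alpha>. \<alpha> \<in> f ` {..<\<beta>} \<Longrightarrow> \<alpha> < \<delta>1"
    using bounded_ordinal by blast
  have "|{\<epsilon>}| \<le>o |UNIV :: 'a set|"
    by (rule card_of_singl_ordLeq) simp
  then obtain \<delta>2 where 2: "\<And>\<alpha>. \<alpha> \<in> {\<epsilon>} \<Longrightarrow> \<alpha> < \<delta>2"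
    using bounded_ordinal by blast
  show thesis
    by (rule that[of "max \<delta>1 \<delta>2"]) (use 1 2 in \<open>auto simp: less_max_iff_disj\<close>)
qed

section \<open>Ordinal arithmetic\<close>

instantiation ordinal :: (type) "{zero, one}"
begin
definition zero_ordinal :: "'a ordinal" where "zero_ordinal = (LEAST \<beta>. True)"
definition one_ordinal :: "'a ordinal" where "one_ordinal = (LEAST \<beta>. 0 < \<beta>)"
instance ..
end

text \<open>
  The recursions below combine the zero, successor and limit cases in one clause:
  \<open>\<alpha> + \<beta> = sup ({\<alpha>} \<union> {\<alpha> + \<gamma> + 1 | \<gamma> < \<beta>})\<close>, \<open>\<alpha> \<cdot> \<beta> = sup {\<alpha> \<cdot> \<gamma> + \<alpha> | \<gamma> < \<beta>}\<close> and
  \<open>\<omega>\<^sup>\<beta> = sup ({1} \<union> {\<omega>\<^sup>\<gamma> \<cdot> \<omega> | \<gamma> < \<beta>})\<close>.  The usual three clauses are derived afterwards.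
\<close>

instantiation ordinal :: (type) "{plus, times}"
begin

function plus_ordinal :: "'a ordinal \<Rightarrow> 'a ordinal \<Rightarrow> 'a ordinal"
  where "plus_ordinal \<alpha> \<beta> = (LEAST \<delta>. \<alpha> \<le> \<delta> \<and> (\<forall>\<gamma>. \<gamma> < \<beta> \<longrightarrow> plus_ordinal \<alpha> \<gamma> < \<delta>))"
  by auto
termination by (relation "inv_image {(x, y). x < y} snd") (auto intro: wf)

declare plus_ordinal.simps [simp del]

function times_ordinal :: "'a ordinal \<Rightarrow> 'a ordinal \<Rightarrow> 'a ordinal"
  where "times_ordinal \<alpha> \<beta> = (LEAST \<delta>. \<forall>\<gamma>. \<gamma> < \<beta> \<longrightarrow> times_ordinal \<alpha> \<gamma> + \<alpha> \<le> \<delta>)"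
  by auto
termination by (relation "inv_image {(x, y). x < y} snd") (auto intro: wf)

declare times_ordinal.simps [simp del]

instance ..

end

definition limit_ordinal :: "'a ordinal \<Rightarrow> bool"
  where "limit_ordinal \<beta> \<longleftrightarrow> \<beta> \<noteq> 0 \<and> (\<forall>\<gamma><\<beta>. \<gamma> + 1 < \<beta>)"

primrec ord_of_nat :: "nat \<Rightarrow> 'a ordinal"
  where
    "ord_of_nat 0 = 0"
  | "ord_of_nat (Suc n) = ord_of_nat n + 1"

definition omega :: "'a ordinal"  (\<open>\<omega>\<close>)
  where "\<omega> = (LEAST \<beta>. \<forall>n. ord_of_nat n < \<beta>)"

function omega_pow :: "'a ordinal \<Rightarrow> 'a ordinal"
  where "omega_pow \<beta> = (LEAST \<delta>. 1 \<le> \<delta> \<and> (\<forall>\<gamma>. \<gamma> < \<beta> \<longrightarrow> omega_pow \<gamma> * \<omega> \<le> \<delta>))"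
  by auto
termination by (relation "{(x, y). x < y}") (auto intro: wf)

declare omega_pow.simps [simp del]


lemma zero_le_ordinal [simp]: "0 \<le> (\<alpha> :: 'a ordinal)"
  by (simp add: zero_ordinal_def Least_le)

lemma not_less_zero_ordinal [simp]: "\<not> (\<alpha> :: 'a ordinal) < 0"
  by (simp add: not_less)

context
  fixes \<alpha> \<beta> :: "'a::infinite ordinal"
begin

lemma plus_ordinal_bounds:
  shows le_plus_ordinal: "\<alpha> \<le> \<alpha> + \<beta>"
    and plus_ordinal_strict_mono: "\<gamma> < \<beta> \<Longrightarrow> \<alpha> + \<gamma> < \<alpha> + \<beta>"
proof -
  obtain \<delta> where "\<alpha> < \<delta>" "\<And>\<gamma>. \<gamma> < \<beta> \<Longrightarrow> \<alpha> + \<gamma> < \<delta>"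
    using bounded_image_ordinal[of \<alpha> \<beta> "\<lambda>\<gamma>. \<alpha> + \<gamma>"] by blast
  then have "\<alpha> \<le> \<alpha> + \<beta> \<and> (\<forall>\<gamma><\<beta>. \<alpha> + \<gamma> < \<alpha> + \<beta>)"
    using LeastI[of "\<lambda>\<delta>. \<alpha> \<le> \<delta> \<and> (\<forall>\<gamma>. \<gamma> < \<beta> \<longrightarrow> \<alpha> + \<gamma> < \<delta>)" \<delta>]
    unfolding plus_ordinal.simps[of \<alpha> \<beta>, symmetric] by (auto intro: less_imp_le)
  then show "\<alpha> \<le> \<alpha> + \<beta>" "\<gamma> < \<beta> \<Longrightarrow> \<alpha> + \<gamma> < \<alpha> + \<beta>"
    by auto
qed

lemma plus_ordinal_least:
  "\<alpha> \<le> \<delta> \<Longrightarrow> (\<And>\<gamma>. \<gamma> < \<beta> \<Longrightarrow> \<alpha> + \<gamma> < \<delta>) \<Longrightarrow> \<alpha> + \<beta> \<le> \<delta>"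
  unfolding plus_ordinal.simps[of \<alpha> \<beta>] by (rule Least_le) blast

lemma times_ordinal_bound: "\<gamma> < \<beta> \<Longrightarrow> \<alpha> * \<gamma> + \<alpha> \<le> \<alpha> * \<beta>"
proof -
  obtain \<delta> where "\<And>\<gamma>. \<gamma> < \<beta> \<Longrightarrow> \<alpha> * \<gamma> + \<alpha> < \<delta>"
    using bounded_image_ordinal[of \<alpha> \<beta> "\<lambda>\<gamma>. \<alpha> * \<gamma> + \<alpha>"] by blast
  then have "\<forall>\<gamma><\<beta>. \<alpha> * \<gamma> + \<alpha> \<le> \<alpha> * \<beta>"
    using LeastI[of "\<lambda>\<delta>. \<forall>\<gamma>. \<gamma> < \<beta> \<longrightarrow> \<alpha> * \<gamma> + \<alpha> \<le> \<delta>" \<delta>]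
    unfolding times_ordinal.simps[of \<alpha> \<beta>, symmetric] by (auto intro: less_imp_le)
  then show "\<gamma> < \<beta> \<Longrightarrow> \<alpha> * \<gamma> + \<alpha> \<le> \<alpha> * \<beta>"
    by auto
qed

lemma times_ordinal_least:
  "(\<And>\<gamma>. \<gamma> < \<beta> \<Longrightarrow> \<alpha> * \<gamma> + \<alpha> \<le> \<delta>) \<Longrightarrow> \<alpha> * \<beta> \<le> \<delta>"
  unfolding times_ordinal.simps[of \<alpha> \<beta>] by (rule Least_le) blast

lemma omega_pow_bounds:
  shows one_le_omega_pow: "1 \<le> omega_pow \<beta>"
    and omega_pow_bound: "\<gamma> < \<beta> \<Longrightarrow> omega_pow \<gamma> * \<omega> \<le> omega_pow \<beta>"
proof -
  obtain \<delta> where "1 < \<delta>" "\<And>\<gamma>. \<gamma> < \<beta> \<Longrightarrow> omega_pow \<gamma> * \<omega> < \<delta>"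
    using bounded_image_ordinal[of 1 \<beta> "\<lambda>\<gamma>. omega_pow \<gamma> * \<omega>"] by blast
  then have "1 \<le> omega_pow \<beta> \<and> (\<forall>\<gamma><\<beta>. omega_pow \<gamma> * \<omega> \<le> omega_pow \<beta>)"
    using LeastI[of "\<lambda>\<delta>. 1 \<le> \<delta> \<and> (\<forall>\<gamma>. \<gamma> < \<beta> \<longrightarrow> omega_pow \<gamma> * \<omega> \<le> \<delta>)" \<delta>]
    unfolding omega_pow.simps[of \<beta>, symmetric] by (auto intro: less_imp_le)
  then show "1 \<le> omega_pow \<beta>" "\<gamma> < \<beta> \<Longrightarrow> omega_pow \<gamma> * \<omega> \<le> omega_pow \<beta>"
    by auto
qed

lemma omega_pow_least:
  "1 \<le> \<delta> \<Longrightarrow> (\<And>\<gamma>. \<gamma> < \<beta> \<Longrightarrow> omega_pow \<gamma> * \<omega> \<le> \<delta>) \<Longrightarrow> omega_pow \<beta> \<le> \<delta>"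
  unfolding omega_pow.simps[of \<beta>] by (rule Least_le) blast

end

lemma zero_less_one_ordinal [simp]: "0 < (1 :: 'a::infinite ordinal)"
proof -
  obtain \<delta> :: "'a ordinal" where "0 < \<delta>"
    using bounded_image_ordinal[of 0 0 id] by blast
  then show ?thesis
    unfolding one_ordinal_def by (rule LeastI)
qed

lemma one_le_ordinal: "0 < \<alpha> \<Longrightarrow> 1 \<le> (\<alpha> :: 'a::infinite ordinal)"
  unfolding one_ordinal_def by (rule Least_le)

lemma less_one_ordinal [simp]: "\<alpha> < 1 \<longleftrightarrow> \<alpha> = (0 :: 'a::infinite ordinal)"
  by (metis less_le not_le one_le_ordinal zero_le_ordinal zero_less_one_ordinal)

lemma plus_zero_ordinal [simp]: "\<alpha> + 0 = (\<alpha> :: 'a::infinite ordinal)"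
  by (intro antisym plus_ordinal_least le_plus_ordinal) auto

lemma plus_one_ordinal_le_iff: "\<alpha> + 1 \<le> \<beta> \<longleftrightarrow> \<alpha> < (\<beta> :: 'a::infinite ordinal)"
proof
  show "\<alpha> < \<beta>" if "\<alpha> + 1 \<le> \<beta>"
    using plus_ordinal_strict_mono[of 0 1 \<alpha>] that by simp
  show "\<alpha> + 1 \<le> \<beta>" if "\<alpha> < \<beta>"
    by (rule plus_ordinal_least) (use that in auto)
qed

lemma less_plus_one_ordinal_iff: "\<gamma> < \<beta> + 1 \<longleftrightarrow> \<gamma> \<le> (\<beta> :: 'a::infinite ordinal)"
  using plus_one_ordinal_le_iff[of \<beta> \<gamma>] by (simp flip: not_le)

lemma plus_plus_one_ordinal: "\<alpha> + (\<beta> + 1) = (\<alpha> + \<beta>) + (1 :: 'a::infinite ordinal)"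
proof (rule antisym)
  show "\<alpha> + (\<beta> + 1) \<le> \<alpha> + \<beta> + 1"
  proof (rule plus_ordinal_least)
    show "\<alpha> \<le> \<alpha> + \<beta> + 1"
      using le_plus_ordinal order_trans by blast
    show "\<alpha> + \<gamma> < \<alpha> + \<beta> + 1" if "\<gamma> < \<beta> + 1" for \<gamma>
      using that plus_ordinal_strict_mono[of \<gamma> \<beta> \<alpha>]
      by (auto simp: less_plus_one_ordinal_iff le_less)
  qed
  show "\<alpha> + \<beta> + 1 \<le> \<alpha> + (\<beta> + 1)"
    by (simp add: plus_one_ordinal_le_iff plus_ordinal_strict_mono less_plus_one_ordinal_iff)
qed

lemma plus_limit_ordinal:
  fixes \<alpha> \<beta> :: "'a::infinite ordinal"
  assumes "limit_ordinal \<beta>"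
  shows "\<alpha> + \<beta> \<le> \<delta> \<longleftrightarrow> (\<forall>\<gamma><\<beta>. \<alpha> + \<gamma> \<le> \<delta>)"
proof
  show "\<forall>\<gamma><\<beta>. \<alpha> + \<gamma> \<le> \<delta>" if "\<alpha> + \<beta> \<le> \<delta>"
    using plus_ordinal_strict_mono that by (meson less_imp_le order_trans)
  show "\<alpha> + \<beta> \<le> \<delta>" if le: "\<forall>\<gamma><\<beta>. \<alpha> + \<gamma> \<le> \<delta>"
  proof (rule plus_ordinal_least)
    have "0 < \<beta>"
      using assms by (simp add: limit_ordinal_def less_le)
    then show "\<alpha> \<le> \<delta>"
      using le by force
    show "\<alpha> + \<gamma> < \<delta>" if "\<gamma> < \<beta>" for \<gamma>
      using assms that le
      by (metis limit_ordinal_def plus_one_ordinal_le_iff plus_plus_one_ordinal)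
  qed
qed

lemma zero_plus_ordinal [simp]: "0 + \<alpha> = (\<alpha> :: 'a::infinite ordinal)"
proof (induction \<alpha> rule: less_induct)
  case (less \<alpha>)
  show ?case
  proof (rule antisym)
    show "0 + \<alpha> \<le> \<alpha>"
      by (rule plus_ordinal_least) (use less in auto)
    show "\<alpha> \<le> 0 + \<alpha>"
      using plus_ordinal_strict_mono[of "0 + \<alpha>" \<alpha> 0] less by (metis less_irrefl not_le)
  qed
qed

lemma times_zero_ordinal [simp]: "\<alpha> * 0 = (0 :: 'a::infinite ordinal)"
  by (intro antisym times_ordinal_least) auto

lemma times_ordinal_mono: "\<gamma> \<le> \<beta> \<Longrightarrow> \<alpha> * \<gamma> \<le> \<alpha> * (\<beta> :: 'a::infinite ordinal)"
  using times_ordinal_bound[of \<gamma> \<beta> \<alpha>] le_plus_ordinal[of "\<alpha> * \<gamma>" \<alpha>]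
  by (metis le_less order_trans)

lemma plus_ordinal_mono_left: "\<alpha> \<le> \<beta> \<Longrightarrow> \<alpha> + \<gamma> \<le> \<beta> + (\<gamma> :: 'a::infinite ordinal)"
proof (induction \<gamma> rule: less_induct)
  case (less \<gamma>)
  show ?case
  proof (rule plus_ordinal_least)
    show "\<alpha> \<le> \<beta> + \<gamma>"
      using less.prems le_plus_ordinal order_trans by blast
    show "\<alpha> + \<eta> < \<beta> + \<gamma>" if "\<eta> < \<gamma>" for \<eta>
      using less that plus_ordinal_strict_mono le_less_trans by blast
  qed
qed

lemma times_plus_one_ordinal: "\<alpha> * (\<beta> + 1) = \<alpha> * \<beta> + (\<alpha> :: 'a::infinite ordinal)"
proof (rule antisym)
  show "\<alpha> * (\<beta> + 1) \<le> \<alpha> * \<beta> + \<alpha>"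
    by (intro times_ordinal_least plus_ordinal_mono_left times_ordinal_mono)
      (simp add: less_plus_one_ordinal_iff)
  show "\<alpha> * \<beta> + \<alpha> \<le> \<alpha> * (\<beta> + 1)"
    by (simp add: times_ordinal_bound less_plus_one_ordinal_iff)
qed

lemma times_limit_ordinal:
  fixes \<alpha> \<beta> :: "'a::infinite ordinal"
  assumes "limit_ordinal \<beta>"
  shows "\<alpha> * \<beta> \<le> \<delta> \<longleftrightarrow> (\<forall>\<gamma><\<beta>. \<alpha> * \<gamma> \<le> \<delta>)"
proof
  show "\<forall>\<gamma><\<beta>. \<alpha> * \<gamma> \<le> \<delta>" if "\<alpha> * \<beta> \<le> \<delta>"
    using times_ordinal_mono that by (meson less_imp_le order_trans)
  show "\<alpha> * \<beta> \<le> \<delta>" if "\<forall>\<gamma><\<beta>. \<alpha> * \<gamma> \<le> \<delta>"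
    using assms that
    by (intro times_ordinal_least) (auto simp: limit_ordinal_def simp flip: times_plus_one_ordinal)
qed

lemma ord_of_nat_less_omega: "ord_of_nat n < (\<omega> :: 'a::infinite ordinal)"
proof -
  have "|UNIV :: nat set| \<le>o |UNIV :: 'a set|"
    using infinite_UNIV by (simp add: infinite_iff_card_of_nat)
  then have "|range (ord_of_nat :: nat \<Rightarrow> 'a ordinal)| \<le>o |UNIV :: 'a set|"
    by (rule ordLeq_transitive[OF card_of_image])
  then obtain \<beta> :: "'a ordinal" where "\<And>\<alpha>. \<alpha> \<in> range ord_of_nat \<Longrightarrow> \<alpha> < \<beta>"
    by (rule bounded_ordinal) blast
  then have "\<forall>n. ord_of_nat n < \<beta>"
    by simp
  then have "\<forall>n. ord_of_nat n < (\<omega> :: 'a ordinal)"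
    unfolding omega_def by (rule LeastI[of "\<lambda>\<beta> :: 'a ordinal. \<forall>n. ord_of_nat n < \<beta>"])
  then show ?thesis ..
qed

lemma less_omegaE:
  assumes "\<alpha> < (\<omega> :: 'a::infinite ordinal)"
  obtains n where "\<alpha> = ord_of_nat n"
proof -
  define n where "n = (LEAST n. \<alpha> \<le> ord_of_nat n)"
  have "\<exists>n. \<alpha> \<le> ord_of_nat n"
  proof (rule ccontr)
    assume "\<not> ?thesis"
    then have "\<forall>n. ord_of_nat n < \<alpha>"
      by (simp add: not_le)
    then have "\<omega> \<le> \<alpha>"
      unfolding omega_def by (rule Least_le)
    with assms show False
      by (simp add: not_less[symmetric])
  qed
  then have le: "\<alpha> \<le> ord_of_nat n"
    unfolding n_def by (rule LeastI_ex)
  have "ord_of_nat n \<le> \<alpha>"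
  proof (cases n)
    case (Suc m)
    then have "\<not> \<alpha> \<le> ord_of_nat m"
      unfolding n_def by (metis lessI not_less_Least)
    then show ?thesis
      by (simp add: Suc plus_one_ordinal_le_iff)
  qed simp
  with le show thesis
    using that by force
qed

lemma omega_pow_zero [simp]: "omega_pow 0 = (1 :: 'a::infinite ordinal)"
  by (intro antisym omega_pow_least one_le_omega_pow) auto

lemma le_times_omega: "\<alpha> \<le> \<alpha> * (\<omega> :: 'a::infinite ordinal)"
  using times_ordinal_bound[OF ord_of_nat_less_omega[of 0], of \<alpha>] by simp

lemma omega_pow_mono: "\<gamma> \<le> \<beta> \<Longrightarrow> omega_pow \<gamma> \<le> omega_pow (\<beta> :: 'a::infinite ordinal)"
  using omega_pow_bound[of \<gamma> \<beta>] le_times_omega[of "omega_pow \<gamma>"] by (metis le_less order_trans)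

lemma times_ordinal_mono_left: "\<alpha> \<le> \<beta> \<Longrightarrow> \<alpha> * \<gamma> \<le> \<beta> * (\<gamma> :: 'a::infinite ordinal)"
proof (induction \<gamma> rule: less_induct)
  case (less \<gamma>)
  have "\<alpha> * \<eta> + \<alpha> \<le> \<beta> * \<gamma>" if "\<eta> < \<gamma>" for \<eta>
  proof -
    have "\<alpha> * \<eta> + \<alpha> \<le> \<beta> * \<eta> + \<alpha>"
      by (rule plus_ordinal_mono_left) (use less that in blast)
    also have "\<dots> \<le> \<beta> * \<eta> + \<beta>"
      using less.prems plus_ordinal_strict_mono[of \<alpha> \<beta> "\<beta> * \<eta>"] by (auto simp: le_less)
    also have "\<dots> \<le> \<beta> * \<gamma>"
      by (rule times_ordinal_bound[OF that])
    finally show ?thesis .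
  qed
  then show ?case
    by (rule times_ordinal_least)
qed

lemma omega_pow_plus_one: "omega_pow (\<beta> + 1) = omega_pow \<beta> * (\<omega> :: 'a::infinite ordinal)"
proof (rule antisym)
  show "omega_pow (\<beta> + 1) \<le> omega_pow \<beta> * \<omega>"
  proof (rule omega_pow_least)
    show "1 \<le> omega_pow \<beta> * \<omega>"
      by (rule order_trans[OF one_le_omega_pow le_times_omega])
    show "omega_pow \<gamma> * \<omega> \<le> omega_pow \<beta> * \<omega>" if "\<gamma> < \<beta> + 1" for \<gamma>
      using that by (intro times_ordinal_mono_left omega_pow_mono) (simp add: less_plus_one_ordinal_iff)
  qed
  show "omega_pow \<beta> * \<omega> \<le> omega_pow (\<beta> + 1)"
    by (simp add: omega_pow_bound less_plus_one_ordinal_iff)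
qed

lemma omega_pow_limit:
  fixes \<beta> :: "'a::infinite ordinal"
  assumes "limit_ordinal \<beta>"
  shows "omega_pow \<beta> \<le> \<delta> \<longleftrightarrow> (\<forall>\<gamma><\<beta>. omega_pow \<gamma> \<le> \<delta>)"
proof
  show "\<forall>\<gamma><\<beta>. omega_pow \<gamma> \<le> \<delta>" if "omega_pow \<beta> \<le> \<delta>"
    using omega_pow_mono that by (meson less_imp_le order_trans)
  show "omega_pow \<beta> \<le> \<delta>" if le: "\<forall>\<gamma><\<beta>. omega_pow \<gamma> \<le> \<delta>"
  proof (rule omega_pow_least)
    have "0 < \<beta>"
      using assms by (simp add: limit_ordinal_def less_le)
    then show "1 \<le> \<delta>"
      using le by (metis omega_pow_zero)
    show "omega_pow \<gamma> * \<omega> \<le> \<delta>" if "\<gamma> < \<beta>" for \<gamma>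
      using assms that le by (auto simp: limit_ordinal_def simp flip: omega_pow_plus_one)
  qed
qed


section \<open>Ramsey numbers\<close>

datatype colour = Red | Blue

text \<open>
  A colouring is given on all sets of ordinals; only its values on \<open>[{..<\<beta>}]\<^sup>2\<close> matter.
  \<open>P\<close> describes the admissible red homogeneous sets.
\<close>

definition arrows :: "('a ordinal set \<Rightarrow> bool) \<Rightarrow> 'a ordinal \<Rightarrow> nat \<Rightarrow> bool"
  where "arrows P \<beta> k \<longleftrightarrow>
    (\<forall>c :: 'a ordinal set \<Rightarrow> colour.
      (\<exists>X \<subseteq> {..<\<beta>}. P X \<and> (\<forall>e \<in> [X]\<^bsup>2\<^esup>. c e = Red)) \<or>
      (\<exists>Y \<in> [{..<\<beta>}]\<^bsup>k\<^esup>. \<forall>e \<in> [Y]\<^bsup>2\<^esup>. c e = Blue))"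

definition order_isomorphic :: "'a ordinal set \<Rightarrow> 'a ordinal set \<Rightarrow> bool"
  where "order_isomorphic X Y \<longleftrightarrow> (\<exists>f. bij_betw f X Y \<and> strict_mono_on X f)"

definition order_homeomorphic :: "'a ordinal set \<Rightarrow> 'a ordinal set \<Rightarrow> bool"
  where "order_homeomorphic X Y \<longleftrightarrow> (\<exists>f g. homeomorphism X Y f g \<and> strict_mono_on X f)"

abbreviation arrows_top :: "'a ordinal \<Rightarrow> 'a ordinal \<Rightarrow> nat \<Rightarrow> bool"
  where "arrows_top \<beta> \<alpha> k \<equiv> arrows (\<lambda>X. X homeomorphic {..<\<alpha>}) \<beta> k"

abbreviation arrows_cl :: "'a ordinal \<Rightarrow> 'a ordinal \<Rightarrow> nat \<Rightarrow> bool"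
  where "arrows_cl \<beta> \<alpha> k \<equiv> arrows (\<lambda>X. order_homeomorphic X {..<\<alpha>}) \<beta> k"

abbreviation arrows_ord :: "'a ordinal \<Rightarrow> 'a ordinal \<Rightarrow> nat \<Rightarrow> bool"
  where "arrows_ord \<beta> \<alpha> k \<equiv> arrows (\<lambda>X. order_isomorphic X {..<\<alpha>}) \<beta> k"

lemma arrows_cl_imp_arrows_top: "arrows_cl \<beta> \<alpha> k \<Longrightarrow> arrows_top \<beta> \<alpha> k"
proof -
  assume cl: "arrows_cl \<beta> \<alpha> k"
  have "X homeomorphic {..<\<alpha>}" if "order_homeomorphic X {..<\<alpha>}" for X
    using that by (auto simp: order_homeomorphic_def homeomorphic_def)
  then show "arrows_top \<beta> \<alpha> k"
    using cl unfolding arrows_def by blast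
qed

text \<open>
  \<open>LEAST\<close> is meaningful only if some \<open>\<beta>\<close> has the respective arrow property.  For \<open>R_cl\<close>, and hence
  for \<open>R_top\<close> by \<open>arrows_cl_imp_arrows_top\<close>, this has to be asserted separately.  For finite \<open>m\<close>,
  \<open>R_ord (ord_of_nat m) k\<close> exists by the finite Ramsey theorem and is the usual Ramsey number.
\<close>

definition R_top :: "'a ordinal \<Rightarrow> nat \<Rightarrow> 'a ordinal"
  where "R_top \<alpha> k = (LEAST \<beta>. arrows_top \<beta> \<alpha> k)"

definition R_cl :: "'a ordinal \<Rightarrow> nat \<Rightarrow> 'a ordinal"
  where "R_cl \<alpha> k = (LEAST \<beta>. arrows_cl \<beta> \<alpha> k)"

definition R_ord :: "'a ordinal \<Rightarrow> nat \<Rightarrow> 'a ordinal"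
  where "R_ord \<alpha> k = (LEAST \<beta>. arrows_ord \<beta> \<alpha> k)"

end

theory Submission
  imports Defs
begin

text \<open>
  The \<open>\<gamma>\<close>-th derivative \<open>derived S \<gamma>\<close> consists of the points of \<open>S\<close> of Cantor-Bendixson rank at
  least \<open>\<gamma>\<close>.  A countable set of ordinals contains a closed copy of \<open>\<omega>\<^sup>\<gamma> \<cdot> m + 1\<close> as soon as it has
  \<open>m\<close> points of rank \<open>\<gamma>\<close>, and a closed copy of \<open>\<omega>\<^sup>\<gamma>\<close>, \<open>\<gamma>\<close> a limit, as soon as its ranks are
  unbounded in \<open>\<gamma>\<close>.  Ranks are invariant under homeomorphisms, so \<open>R_top = R_cl\<close> for these ordinals, and
  the upper bounds become statements about ranks, which are proved by induction on the size of the
  blue set.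

  In the induction step let \<open>\<beta> = \<omega>\<^sup>\<zeta>\<close>.  If the ranks of some blue neighbourhood are unbounded in \<open>\<beta>\<close>,
  the induction hypothesis applies to it.  Otherwise all blue neighbourhoods are thin, and removing
  finitely many thin sets does not lower a rank of the form \<open>\<beta> \<cdot> \<delta>\<close> at the remaining points, because
  \<open>\<beta>\<close> is closed under natural sums.  Hence one can choose points one at a time, each red to all earlier
  ones, so that a point of rank \<open>\<beta> \<cdot> \<delta>\<close> in the given set ends up with rank \<open>\<delta>\<close> in the red set.
\<close>

section \<open>Ordinal arithmetic\<close>

text \<open>The exponents count multiplications. One more blue point multiplies the rank required of
  the given set by some \<open>omega_pow \<zeta>\<close> on the left, and
  \<open>omega_pow \<zeta>\<close> must be so large that a blue neighbourhood which is not thin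
  meets the requirement of the induction hypothesis. If only unbounded ranks are wanted, it may
  equal that requirement, which gives \<open>\<alpha> * k\<close>; if points of an exact rank are
  wanted, it has to exceed it.

  Countability is used twice. Only finitely many thin sets can be discarded at a time, so all
  requirements "a red point of large rank in this basic neighbourhood" must be met in
  \<open>\<omega>\<close> steps; and closed sets of given rank are assembled along an increasing
  \<open>\<omega>\<close>-sequence.

  The finite Ramsey number affects only the outermost step: a blue neighbourhood that is not thin
  has infinitely many points of the rank needed there, so that inside it a Ramsey number of any size
  is available at no cost.\<close>

lemma le_zero_ordinal_iff [simp]: "a \<le> 0 \<longleftrightarrow> a = (0 :: 'a ordinal)"
  by (simp add: antisym_conv)

context
  fixes a b :: "'a::infinite ordinal"
begin

lemma le_plus_ordinal_right: "b \<le> a + b"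
  using plus_ordinal_mono_left[of 0 a b] by simp

lemma plus_ordinal_mono: "c \<le> d \<Longrightarrow> a + c \<le> a + (d :: 'a ordinal)"
  by (metis le_less plus_ordinal_strict_mono)

lemma le_ordinalE:
  assumes "a \<le> b"
  obtains c where "b = a + c"
proof -
  define c where "c = (LEAST c. b \<le> a + c)"
  have "b \<le> a + c"
    unfolding c_def by (rule LeastI[of _ b]) (rule le_plus_ordinal_right)
  moreover have "a + c \<le> b"
  proof (rule plus_ordinal_least)
    show "a + d < b" if "d < c" for d
      using not_less_Least that unfolding c_def by fastforce
  qed (rule assms)
  ultimately show thesis
    using that by force
qed

lemma plus_ordinal_less_iff: "a + c < a + d \<longleftrightarrow> c < (d :: 'a ordinal)"
  by (metis not_less plus_ordinal_mono plus_ordinal_strict_mono)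

lemma less_times_ordinalE:
  assumes "x < a * b"
  obtains c where "c < b" "x < a * c + a"
  using assms times_ordinal_least[of b a x] by (force simp: not_le)

end

lemma less_plus_ordinalE:
  fixes a b :: "'a::infinite ordinal"
  assumes "x < a + b"
  obtains "x < a" | c where "c < b" "x = a + c"
proof (cases "x < a")
  case False
  then obtain c where "x = a + c"
    using le_ordinalE not_less by metis
  then show ?thesis
    using assms that plus_ordinal_less_iff by blast
qed

lemma plus_ordinal_assoc: "(a + b) + c = a + (b + c :: 'a::infinite ordinal)"
proof (induction c rule: less_induct)
  case (less c)
  show ?case
  proof (rule antisym)
    show "a + b + c \<le> a + (b + c)"
      by (rule plus_ordinal_least)
        (auto simp: less plus_ordinal_mono le_plus_ordinal plus_ordinal_strict_mono)
    show "a + (b + c) \<le> a + b + c"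
    proof (rule plus_ordinal_least)
      show "a \<le> a + b + c"
        using le_plus_ordinal order_trans by blast
      fix d assume "d < b + c"
      then show "a + d < a + b + c"
      proof (cases rule: less_plus_ordinalE)
        case 1
        then show ?thesis
          using le_plus_ordinal less_le_trans plus_ordinal_strict_mono by blast
      next
        case (2 e)
        then show ?thesis
          using less plus_ordinal_strict_mono by metis
      qed
    qed
  qed
qed

lemma times_one_ordinal [simp]: "a * 1 = (a :: 'a::infinite ordinal)"
  using times_plus_one_ordinal[of a 0] by simp

lemma one_times_ordinal: "1 * a = (a :: 'a::infinite ordinal)"
proof (induction a rule: less_induct)
  case (less a)
  show ?case
  proof (rule antisym)
    show "1 * a \<le> a"
      by (rule times_ordinal_least) (simp add: less plus_one_ordinal_le_iff)
    show "a \<le> 1 * a"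
    proof (rule ccontr)
      \<comment> \<open>If \<open>1 * a < a\<close>, then \<open>1 * a\<close> is itself an index
        below \<open>a\<close>, and the induction hypothesis at \<open>1 * a\<close> turns the bound
        into \<open>1 * a + 1 \<le> 1 * a\<close>.\<close>
      assume "\<not> a \<le> 1 * a"
      then have "1 * (1 * a) + 1 \<le> 1 * a"
        by (intro times_ordinal_bound) simp
      then show False
        using less[of "1 * a"] \<open>\<not> a \<le> 1 * a\<close> by (simp add: plus_one_ordinal_le_iff)
    qed
  qed
qed

lemma times_plus_ordinal: "a * (b + c) = a * b + a * (c :: 'a::infinite ordinal)"
proof (induction c rule: less_induct)
  case (less c)
  have step: "a * (b + e) + a = a * b + (a * e + a)" if "e < c" for e
    using less[OF that] by (simp add: plus_ordinal_assoc)
  show ?case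
  proof (rule antisym)
    show "a * (b + c) \<le> a * b + a * c"
    proof (rule times_ordinal_least)
      fix d assume "d < b + c"
      then show "a * d + a \<le> a * b + a * c"
      proof (cases rule: less_plus_ordinalE)
        case 1
        then show ?thesis
          using times_ordinal_bound le_plus_ordinal order_trans by blast
      next
        case (2 e)
        then show ?thesis
          using step times_ordinal_bound plus_ordinal_mono by metis
      qed
    qed
    show "a * b + a * c \<le> a * (b + c)"
    proof (rule plus_ordinal_least)
      show "a * b \<le> a * (b + c)"
        by (intro times_ordinal_mono le_plus_ordinal)
      fix x assume "x < a * c"
      then obtain e where e: "e < c" "x < a * e + a"
        by (rule less_times_ordinalE)
      then have "a * b + x < a * (b + e) + a"
        by (simp add: step plus_ordinal_strict_mono)
      also have "\<dots> \<le> a * (b + c)"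
        by (intro times_ordinal_bound plus_ordinal_strict_mono e)
      finally show "a * b + x < a * (b + c)" .
    qed
  qed
qed

lemma times_ordinal_assoc: "(a * b) * c = a * (b * c :: 'a::infinite ordinal)"
proof (induction c rule: less_induct)
  case (less c)
  show ?case
  proof (rule antisym)
    show "a * b * c \<le> a * (b * c)"
      by (rule times_ordinal_least)
        (simp add: less times_ordinal_bound times_ordinal_mono flip: times_plus_ordinal)
    show "a * (b * c) \<le> a * b * c"
    proof (rule times_ordinal_least)
      fix d assume "d < b * c"
      then obtain e where e: "e < c" "d < b * e + b"
        by (rule less_times_ordinalE)
      then have "a * d + a \<le> a * (b * e + b)"
        by (simp add: times_ordinal_bound)
      also have "\<dots> = a * b * e + a * b"
        using e less by (simp add: times_plus_ordinal)
      also have "\<dots> \<le> a * b * c"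
        by (intro times_ordinal_bound e)
      finally show "a * d + a \<le> a * b * c" .
    qed
  qed
qed

lemma times_ordinal_strict_mono: "0 < a \<Longrightarrow> b < c \<Longrightarrow> a * b < a * (c :: 'a::infinite ordinal)"
  by (metis less_le_trans plus_ordinal_strict_mono plus_zero_ordinal times_ordinal_bound)

section \<open>Finite ordinals and powers of omega\<close>

lemma omega_pow_pos [simp]: "0 < omega_pow (a :: 'a::infinite ordinal)"
  using one_le_omega_pow[of a] zero_less_one_ordinal less_le_trans by blast

lemma ord_of_nat_add: "ord_of_nat (m + n) = ord_of_nat m + (ord_of_nat n :: 'a::infinite ordinal)"
  by (induction n) (simp_all add: plus_plus_one_ordinal)

lemma ord_of_nat_strict_mono: "m < n \<Longrightarrow> ord_of_nat m < (ord_of_nat n :: 'a::infinite ordinal)"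
proof (induction n)
  case (Suc n)
  then show ?case
    by (cases "m = n") (auto simp: less_plus_one_ordinal_iff intro: less_imp_le)
qed simp

lemma ord_of_nat_le_iff [simp]: "ord_of_nat m \<le> (ord_of_nat n :: 'a::infinite ordinal) \<longleftrightarrow> m \<le> n"
  by (metis le_less linorder_not_le ord_of_nat_strict_mono)

lemma less_times_omegaE:
  assumes "x < a * (\<omega> :: 'a::infinite ordinal)"
  obtains j where "x < a * ord_of_nat j"
proof -
  obtain c where "c < \<omega>" "x < a * c + a"
    using assms by (rule less_times_ordinalE)
  moreover obtain n where "c = ord_of_nat n"
    using \<open>c < \<omega>\<close> by (rule less_omegaE)
  ultimately have "x < a * ord_of_nat (Suc n)"
    by (simp add: times_plus_ordinal)
  then show thesis
    by (rule that)
qed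

lemma times_omega_leI:
  "(\<And>n. a * ord_of_nat n \<le> d) \<Longrightarrow> a * (\<omega> :: 'a::infinite ordinal) \<le> d"
  by (metis less_times_omegaE not_le)

text \<open>\<open>omega_pow b\<close> is the supremum of 1 and all
  \<open>omega_pow c * \<omega>\<close> with \<open>c < b\<close>. The case \<open>x = 0\<close> is
  separate because no \<open>c\<close> exists if \<open>b = 0\<close>.\<close>

lemma less_omega_powE:
  assumes "x < omega_pow (b :: 'a::infinite ordinal)"
  obtains "x = 0" | c j where "c < b" "x < omega_pow c * ord_of_nat j"
proof (cases "x = 0")
  case False
  then obtain c where "c < b" "x < omega_pow c * \<omega>"
    using assms omega_pow_least[of x b] by (metis less_one_ordinal not_le)
  then show thesis
    using that(2) less_times_omegaE by blast
qed

lemma times_ordinal_ord_of_nat_less: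
  "omega_pow c * ord_of_nat j < omega_pow c * (\<omega> :: 'a::infinite ordinal)"
  by (rule times_ordinal_strict_mono[OF omega_pow_pos ord_of_nat_less_omega])

lemma omega_pow_strict_mono: "a < b \<Longrightarrow> omega_pow a < omega_pow (b :: 'a::infinite ordinal)"
  using times_ordinal_ord_of_nat_less[of a 1] omega_pow_bound[of a b] by simp

lemma omega_pow_plus: "omega_pow (a + b) = omega_pow a * omega_pow (b :: 'a::infinite ordinal)"
proof (induction b rule: less_induct)
  case (less b)
  have step: "omega_pow (a + e) * \<omega> = omega_pow a * (omega_pow e * \<omega>)" if "e < b" for e
    using less[OF that] by (simp add: times_ordinal_assoc)
  have le: "omega_pow a \<le> omega_pow a * omega_pow b"
    using times_ordinal_mono[OF one_le_omega_pow, of "omega_pow a" b] by simp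
  show ?case
  proof (rule antisym)
    show "omega_pow (a + b) \<le> omega_pow a * omega_pow b"
    proof (rule omega_pow_least)
      show "1 \<le> omega_pow a * omega_pow b"
        using le one_le_omega_pow order_trans by blast
      fix d assume "d < a + b"
      then show "omega_pow d * \<omega> \<le> omega_pow a * omega_pow b"
      proof (cases rule: less_plus_ordinalE)
        case 1
        then show ?thesis
          using omega_pow_bound le order_trans by blast
      next
        case (2 e)
        then show ?thesis
          by (simp add: step times_ordinal_mono omega_pow_bound)
      qed
    qed
    show "omega_pow a * omega_pow b \<le> omega_pow (a + b)"
    proof (rule times_ordinal_least)
      fix c assume "c < omega_pow b"
      then show "omega_pow a * c + omega_pow a \<le> omega_pow (a + b)"
      proof (cases rule: less_omega_powE)
        case 1
        then show ?thesis
          by (simp add: omega_pow_mono le_plus_ordinal)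
      next
        case (2 e j)
        have "c < omega_pow e * \<omega>"
          using 2(2) times_ordinal_ord_of_nat_less less_trans by blast
        then have "omega_pow a * c + omega_pow a \<le> omega_pow (a + e) * \<omega>"
          unfolding step[OF 2(1)] by (rule times_ordinal_bound)
        also have "\<dots> \<le> omega_pow (a + b)"
          by (intro omega_pow_bound plus_ordinal_strict_mono 2)
        finally show ?thesis .
      qed
    qed
  qed
qed

lemma limit_ordinal_omega_pow:
  assumes "0 < (b :: 'a::infinite ordinal)"
  shows "limit_ordinal (omega_pow b)"
  unfolding limit_ordinal_def
proof (intro conjI allI impI)
  show "omega_pow b \<noteq> 0"
    using omega_pow_pos[of b] by (metis less_irrefl)
  fix x assume "x < omega_pow b"
  then show "x + 1 < omega_pow b"
  proof (cases rule: less_omega_powE)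
    case 1
    then show ?thesis
      using omega_pow_strict_mono[OF assms] by simp
  next
    case (2 c j)
    then have "x + 1 \<le> omega_pow c * ord_of_nat j"
      by (simp add: plus_one_ordinal_le_iff)
    also have "\<dots> < omega_pow c * \<omega>"
      by (rule times_ordinal_ord_of_nat_less)
    also have "\<dots> \<le> omega_pow b"
      using 2 by (intro omega_pow_bound)
    finally show ?thesis .
  qed
qed

text \<open>An infinite ordinal has the form \<open>\<omega> + c\<close>, and
  \<open>1 + \<omega> = \<omega>\<close>. This removes the extra summands of
  \<open>tower_exponent\<close>.\<close>

lemma one_plus_infinite_ordinal:
  assumes "infinite {..<a :: 'a::infinite ordinal}"
  shows "1 + a = a"
proof -
  have "finite {..<ord_of_nat n :: 'a ordinal}" for n
  proof (induction n)
    case 0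
    have "{..<0 :: 'a ordinal} = {}"
      by auto
    then show ?case
      by simp
  next
    case (Suc n)
    have "{..<ord_of_nat (Suc n) :: 'a ordinal} = insert (ord_of_nat n) {..<ord_of_nat n}"
      by (auto simp: less_plus_one_ordinal_iff)
    then show ?case
      using Suc by simp
  qed
  then have "\<omega> \<le> a"
    using assms by (metis less_omegaE not_le)
  then obtain c where c: "a = \<omega> + c"
    by (rule le_ordinalE)
  have "1 + \<omega> \<le> (\<omega> :: 'a ordinal)"
  proof (rule plus_ordinal_least)
    show "1 \<le> (\<omega> :: 'a ordinal)"
      using ord_of_nat_less_omega[of 1, where 'a = 'a] by simp
    fix x :: "'a ordinal" assume "x < \<omega>"
    then obtain n where "x = ord_of_nat n"
      by (rule less_omegaE)
    then have "1 + x = ord_of_nat (1 + n)"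
      unfolding ord_of_nat_add by simp
    then show "1 + x < \<omega>"
      by (simp only: ord_of_nat_less_omega)
  qed
  then have "1 + \<omega> = (\<omega> :: 'a ordinal)"
    using le_plus_ordinal_right antisym by blast
  then show ?thesis
    unfolding c by (simp flip: plus_ordinal_assoc)
qed

section \<open>Countability of sums, products and powers\<close>

lemma countable_lessThan_plus_ordinal:
  assumes "countable {..<a :: 'a::infinite ordinal}" "countable {..<b}"
  shows "countable {..<a + b}"
proof -
  have "{..<a + b} \<subseteq> {..<a} \<union> (+) a ` {..<b}"
    by (auto elim: less_plus_ordinalE)
  then show ?thesis
    by (rule countable_subset) (simp add: assms)
qed

lemma countable_lessThan_times_ordinal:
  assumes "countable {..<a :: 'a::infinite ordinal}" "countable {..<b}"
  shows "countable {..<a * b}"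
  using assms(2)
proof (induction b rule: less_induct)
  case (less b)
  have "countable {..<a * c + a}" if "c < b" for c
  proof (rule countable_lessThan_plus_ordinal[OF less.IH[OF that] assms(1)])
    show "countable {..<c}"
      by (rule countable_subset[OF _ less.prems]) (use that in auto)
  qed
  then have "countable (\<Union>c\<in>{..<b}. {..<a * c + a})"
    using less.prems by blast
  moreover have "{..<a * b} \<subseteq> (\<Union>c\<in>{..<b}. {..<a * c + a})"
    by (auto elim: less_times_ordinalE)
  ultimately show ?case
    by (metis countable_subset)
qed

lemma countable_lessThan_omega: "countable {..<\<omega> :: 'a::infinite ordinal}"
proof (rule countable_subset)
  show "{..<\<omega> :: 'a ordinal} \<subseteq> range ord_of_nat"
    by (auto elim: less_omegaE)
qed simp

lemma countable_lessThan_ord_of_nat: "countable {..<ord_of_nat n :: 'a::infinite ordinal}"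
  by (rule countable_subset[OF _ countable_lessThan_omega])
    (auto intro: less_imp_le ord_of_nat_less_omega)

lemma countable_lessThan_omega_pow:
  assumes "countable {..<b :: 'a::infinite ordinal}"
  shows "countable {..<omega_pow b}"
  using assms
proof (induction b rule: less_induct)
  case (less b)
  have "countable {..<omega_pow c * ord_of_nat j}" if "c < b" for c j
  proof (intro countable_lessThan_times_ordinal countable_lessThan_ord_of_nat less.IH[OF that])
    show "countable {..<c}"
      by (rule countable_subset[OF _ less.prems]) (use that in auto)
  qed
  then have "countable (\<Union>c\<in>{..<b}. \<Union>j. {..<omega_pow c * ord_of_nat j})"
    using less.prems by blast
  moreover have "{..<omega_pow b} \<subseteq> insert 0 (\<Union>c\<in>{..<b}. \<Union>j. {..<omega_pow c * ord_of_nat j})"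
    by (auto elim: less_omega_powE)
  ultimately show ?case
    by (metis countable_insert countable_subset)
qed

text \<open>Hessenberg's natural sum, given as the least operation strictly increasing in both
  arguments instead of by Cantor normal forms: the induction for derivatives of a union uses exactly
  this strict monotonicity.\<close>

function natural_sum :: "'a ordinal \<Rightarrow> 'a ordinal \<Rightarrow> 'a ordinal"
  where "natural_sum a b =
    (LEAST d. (\<forall>a'. a' < a \<longrightarrow> natural_sum a' b < d) \<and> (\<forall>b'. b' < b \<longrightarrow> natural_sum a b' < d))"
  by auto
termination
  by (relation "{(x, y). x < y} <*lex*> {(x, y). x < y}") (auto intro: wf)

declare natural_sum.simps [simp del]

context
  fixes a b :: "'a::infinite ordinal"
begin

lemma natural_sum_strict_mono:
  shows natural_sum_strict_mono_left: "a' < a \<Longrightarrow> natural_sum a' b < natural_sum a b"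
    and natural_sum_strict_mono_right: "b' < b \<Longrightarrow> natural_sum a b' < natural_sum a b"
proof -
  obtain d where d: "\<And>a'. a' < a \<Longrightarrow> natural_sum a' b < d"
    using bounded_image_ordinal[of 0 a "\<lambda>x. natural_sum x b"] by blast
  obtain e where e: "\<And>b'. b' < b \<Longrightarrow> natural_sum a b' < e"
    using bounded_image_ordinal[of 0 b "natural_sum a"] by blast
  have "(\<forall>a'. a' < a \<longrightarrow> natural_sum a' b < natural_sum a b) \<and>
      (\<forall>b'. b' < b \<longrightarrow> natural_sum a b' < natural_sum a b)"
    unfolding natural_sum.simps[of a b] using d e
    by (intro LeastI[of "\<lambda>d. (\<forall>a'. a' < a \<longrightarrow> natural_sum a' b < d) \<and>
      (\<forall>b'. b' < b \<longrightarrow> natural_sum a b' < d)" "max d e"]) (auto simp: less_max_iff_disj)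
  then show "a' < a \<Longrightarrow> natural_sum a' b < natural_sum a b"
    "b' < b \<Longrightarrow> natural_sum a b' < natural_sum a b"
    by auto
qed

lemma natural_sum_least:
  "(\<And>a'. a' < a \<Longrightarrow> natural_sum a' b < d) \<Longrightarrow> (\<And>b'. b' < b \<Longrightarrow> natural_sum a b' < d) \<Longrightarrow>
    natural_sum a b \<le> d"
  unfolding natural_sum.simps[of a b] by (rule Least_le) blast

end

lemma less_times_ord_of_natE:
  fixes w :: "'a::infinite ordinal"
  assumes "x < w * ord_of_nat j"
  obtains i y where "i < j" "y < w" "x = w * ord_of_nat i + y"
  using assms
proof (induction j arbitrary: thesis)
  case (Suc j)
  from Suc.prems(2) have "x < w * ord_of_nat j + w"
    by (simp add: times_plus_ordinal)
  then show ?case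
  proof (cases rule: less_plus_ordinalE)
    case 1
    then show ?thesis
      by (rule Suc.IH[rotated]) (rule Suc.prems(1)[OF less_SucI])
  next
    case (2 c)
    then show ?thesis
      by (intro Suc.prems(1)[of j c]) simp_all
  qed
qed simp

lemma less_multiple_plusE:
  fixes w :: "'a::infinite ordinal"
  assumes "x < w * ord_of_nat i + y" "y < w"
  obtains i' y' where "y' < w" "x = w * ord_of_nat i' + y'" "i' < i \<or> i' = i \<and> y' < y"
  using assms(1)
proof (cases rule: less_plus_ordinalE)
  case 1
  then show ?thesis
    using that by (metis less_times_ord_of_natE)
next
  case (2 c)
  then show ?thesis
    using that assms(2) less_trans by blast
qed

text \<open>Coefficients of \<open>w\<close> and remainders can be added separately. The nested
  inductions follow the recursion of \<open>natural_sum\<close>: a smaller argument has either a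
  smaller coefficient, and closure keeps the sum of the remainders below \<open>w\<close>, or the
  same coefficient and a smaller remainder.\<close>

lemma natural_sum_multiples_le:
  fixes w :: "'a::infinite ordinal"
  assumes closed: "\<And>x y. x < w \<Longrightarrow> y < w \<Longrightarrow> natural_sum x y < w" and "x < w" "y < w"
  shows "natural_sum (w * ord_of_nat i + x) (w * ord_of_nat j + y)
    \<le> w * ord_of_nat (i + j) + natural_sum x y"
  using assms(2,3)
proof (induction "w * ord_of_nat i + x" arbitrary: i x j y rule: less_induct)
  case outer: less
  show ?case
    using outer.prems
  proof (induction "w * ord_of_nat j + y" arbitrary: j y rule: less_induct)
    case inner: less
    \<comment> \<open>A smaller coefficient loses a whole \<open>w\<close>, which outweighs every
      remainder \<open>z < w\<close>.\<close>
    have below: "w * ord_of_nat n + z < w * ord_of_nat (i + j) + natural_sum x y"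
      if "z < w" "n < i + j" for n z
    proof -
      have "w * ord_of_nat n + z < w * ord_of_nat (Suc n)"
        using that(1) by (simp add: times_plus_ordinal plus_ordinal_strict_mono)
      also have "\<dots> \<le> w * ord_of_nat (i + j)"
        using that(2) by (simp del: ord_of_nat.simps add: times_ordinal_mono)
      also have "\<dots> \<le> w * ord_of_nat (i + j) + natural_sum x y"
        by (rule le_plus_ordinal)
      finally show ?thesis .
    qed
    show ?case
    proof (rule natural_sum_least)
      fix a assume a: "a < w * ord_of_nat i + x"
      then obtain i' x' where *: "x' < w" "a = w * ord_of_nat i' + x'" "i' < i \<or> i' = i \<and> x' < x"
        using inner.prems(1) by (rule less_multiple_plusE)
      have "natural_sum a (w * ord_of_nat j + y) \<le> w * ord_of_nat (i' + j) + natural_sum x' y"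
        using outer.hyps[of i' x' y j] a inner.prems * by simp
      also have "\<dots> < w * ord_of_nat (i + j) + natural_sum x y"
        using * below[of "natural_sum x' y" "i' + j"] inner.prems
        by (auto simp: closed plus_ordinal_strict_mono natural_sum_strict_mono_left)
      finally show "natural_sum a (w * ord_of_nat j + y) < w * ord_of_nat (i + j) + natural_sum x y" .
    next
      fix b assume b: "b < w * ord_of_nat j + y"
      then obtain j' y' where *: "y' < w" "b = w * ord_of_nat j' + y'" "j' < j \<or> j' = j \<and> y' < y"
        using inner.prems(2) by (rule less_multiple_plusE)
      have "natural_sum (w * ord_of_nat i + x) b \<le> w * ord_of_nat (i + j') + natural_sum x y'"
        using inner.hyps[of j' y'] b inner.prems * by simp
      also have "\<dots> < w * ord_of_nat (i + j) + natural_sum x y"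
        using * below[of "natural_sum x y'" "i + j'"] inner.prems
        by (auto simp: closed plus_ordinal_strict_mono natural_sum_strict_mono_right)
      finally show "natural_sum (w * ord_of_nat i + x) b < w * ord_of_nat (i + j) + natural_sum x y" .
    qed
  qed
qed

text \<open>Both arguments lie below finite multiples of a common \<open>omega_pow d\<close> with
  \<open>d < z\<close>. By the induction hypothesis \<open>omega_pow d\<close> is closed under
  natural sums, so the sum is again below a finite multiple of it.\<close>

lemma natural_sum_less_omega_pow:
  fixes x y z :: "'a::infinite ordinal"
  assumes "x < omega_pow z" "y < omega_pow z"
  shows "natural_sum x y < omega_pow z"
  using assms
proof (induction z arbitrary: x y rule: less_induct)
  case (less z)
  show ?case
  proof (cases "z = 0")
    case True
    then have "x = 0" "y = 0"
      using less.prems by auto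
    have "natural_sum 0 0 \<le> (0 :: 'a ordinal)"
      by (rule natural_sum_least) simp_all
    then have "natural_sum x y \<le> 0"
      by (simp only: \<open>x = 0\<close> \<open>y = 0\<close>)
    then show ?thesis
      using omega_pow_pos[of z] by (rule le_less_trans)
  next
    case False
    have ex: "\<exists>c<z. \<exists>j. x < omega_pow c * ord_of_nat j" if "x < omega_pow z" for x
      using that
    proof (cases rule: less_omega_powE)
      case 1
      then have "x < omega_pow 0 * ord_of_nat 1"
        by simp
      then show ?thesis
        using False by (metis zero_le_ordinal le_less)
    qed blast
    obtain c j where c: "c < z" "x < omega_pow c * ord_of_nat j"
      using ex less.prems(1) by blast
    obtain c' j' where c': "c' < z" "y < omega_pow c' * ord_of_nat j'"
      using ex less.prems(2) by blast
    define d where "d = max c c'"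
    have d: "d < z"
      using c c' by (simp add: d_def)
    have "omega_pow c * ord_of_nat j \<le> omega_pow d * ord_of_nat j"
      "omega_pow c' * ord_of_nat j' \<le> omega_pow d * ord_of_nat j'"
      by (simp_all add: d_def times_ordinal_mono_left omega_pow_mono)
    then have *: "x < omega_pow d * ord_of_nat j" "y < omega_pow d * ord_of_nat j'"
      using c(2) c'(2) less_le_trans by blast+
    from *(1) obtain i x' where x: "x' < omega_pow d" "x = omega_pow d * ord_of_nat i + x'"
      by (rule less_times_ord_of_natE)
    from *(2) obtain i' y' where y: "y' < omega_pow d" "y = omega_pow d * ord_of_nat i' + y'"
      by (rule less_times_ord_of_natE)
    have "natural_sum x y \<le> omega_pow d * ord_of_nat (i + i') + natural_sum x' y'"
      unfolding x y by (rule natural_sum_multiples_le[OF less.IH[OF d] x(1) y(1)])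
    also have "\<dots> < omega_pow d * ord_of_nat (i + i') + omega_pow d"
      by (intro plus_ordinal_strict_mono less.IH d x y)
    also have "\<dots> = omega_pow d * ord_of_nat (Suc (i + i'))"
      by (simp add: times_plus_ordinal)
    also have "\<dots> < omega_pow d * \<omega>"
      by (rule times_ordinal_ord_of_nat_less)
    also have "\<dots> \<le> omega_pow z"
      by (rule omega_pow_bound[OF d])
    finally show ?thesis .
  qed
qed

section \<open>Iterated derivatives\<close>

text \<open>The derivatives are taken in the subspace \<open>S\<close>: limit points outside
  \<open>S\<close> are dropped at every stage, so ranks make sense for red sets that are not closed.
  One clause covers zero, successor and limit stages.\<close>

function derived :: "'b::topological_space set \<Rightarrow> 'a ordinal \<Rightarrow> 'b set"
  where "derived S \<gamma> = {p \<in> S. \<forall>\<delta>. \<delta> < \<gamma> \<longrightarrow> p islimpt derived S \<delta>}"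
  by auto
termination
  by (relation "inv_image {(x, y). x < y} snd") (auto intro: wf)

declare derived.simps [simp del]

lemma mem_derived_iff: "p \<in> derived S \<gamma> \<longleftrightarrow> p \<in> S \<and> (\<forall>\<delta><\<gamma>. p islimpt derived S \<delta>)"
  by (subst derived.simps) simp

lemma derived_subset: "derived S \<gamma> \<subseteq> S"
  by (auto simp: mem_derived_iff)

lemma derived_zero [simp]: "derived S 0 = S"
  by (auto simp: mem_derived_iff)

lemma derived_antimono: "\<gamma> \<le> \<delta> \<Longrightarrow> derived S \<delta> \<subseteq> derived S \<gamma>"
  by (auto simp: mem_derived_iff)

lemma derived_mono: "S \<subseteq> T \<Longrightarrow> derived S \<gamma> \<subseteq> derived T \<gamma>"
proof (induction \<gamma> rule: less_induct)
  case (less \<gamma>)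
  then have "p islimpt derived T \<delta>" if "p islimpt derived S \<delta>" "\<delta> < \<gamma>" for p \<delta>
    using that islimpt_subset by metis
  then show ?case
    using less.prems by (auto simp: mem_derived_iff)
qed

lemma islimpt_Int_open:
  assumes "open V" "p \<in> V"
  shows "p islimpt (D \<inter> V) \<longleftrightarrow> p islimpt D"
proof
  assume "p islimpt D"
  then have "\<exists>y\<in>D. y \<in> T \<inter> V \<and> y \<noteq> p" if "p \<in> T" "open T" for T
    using assms that unfolding islimpt_def by blast
  then show "p islimpt (D \<inter> V)"
    unfolding islimpt_def by blast
qed (auto intro: islimpt_subset)

text \<open>Ranks are local, which allows later arguments to pass to a neighbourhood of one
  point.\<close>

lemma derived_Int_open:
  assumes "open V"
  shows "derived (S \<inter> V) \<gamma> = derived S \<gamma> \<inter> V"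
proof (induction \<gamma> rule: less_induct)
  case (less \<gamma>)
  then have "p islimpt derived (S \<inter> V) \<delta> \<longleftrightarrow> p islimpt derived S \<delta>" if "p \<in> V" "\<delta> < \<gamma>" for p \<delta>
    using that islimpt_Int_open[OF assms] by metis
  then show ?case
    by (auto simp: mem_derived_iff)
qed

lemma derived_derived:
  fixes \<sigma> :: "'a::infinite ordinal"
  shows "derived (derived S \<sigma>) \<epsilon> = derived S (\<sigma> + \<epsilon>)"
proof (induction \<epsilon> rule: less_induct)
  case (less \<epsilon>)
  show ?case
  proof (intro equalityI subsetI)
    fix p assume p: "p \<in> derived (derived S \<sigma>) \<epsilon>"
    then have S: "p \<in> derived S \<sigma>"
      using derived_subset by blast
    have "p islimpt derived S \<tau>" if "\<tau> < \<sigma> + \<epsilon>" for \<tau>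
      using that
    proof (cases rule: less_plus_ordinalE)
      case 1
      then show ?thesis
        using S mem_derived_iff by blast
    next
      case (2 c)
      then show ?thesis
        using p less by (simp add: mem_derived_iff)
    qed
    then show "p \<in> derived S (\<sigma> + \<epsilon>)"
      using S by (meson mem_derived_iff)
  next
    fix p assume p: "p \<in> derived S (\<sigma> + \<epsilon>)"
    then have "p \<in> derived S \<sigma>"
      using derived_antimono[OF le_plus_ordinal] by blast
    moreover have "p islimpt derived (derived S \<sigma>) \<delta>" if "\<delta> < \<epsilon>" for \<delta>
      using p less[OF that] plus_ordinal_strict_mono[OF that, of \<sigma>] by (simp add: mem_derived_iff)
    ultimately show "p \<in> derived (derived S \<sigma>) \<epsilon>"
      by (meson mem_derived_iff)
  qed
qed

text \<open>\<open>V\<close> is a punctured neighbourhood of \<open>p\<close> that avoids all points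
  of rank \<open>\<delta>\<close>; it is open by the T1 property. Puncturing matters because
  \<open>p\<close> itself may have rank \<open>\<delta>\<close>, while limits at \<open>p\<close> do
  not notice the removal of \<open>p\<close>.\<close>

lemma not_mem_derivedE:
  fixes S :: "'b::t1_space set"
  assumes "p \<in> S" "p \<notin> derived S \<epsilon>"
  obtains \<delta> V where "\<delta> < \<epsilon>" "open V" "p \<notin> V" "derived (S \<inter> V) \<delta> = {}"
    "\<And>D. p islimpt D \<longleftrightarrow> p islimpt (D \<inter> V)"
proof -
  obtain \<delta> where \<delta>: "\<delta> < \<epsilon>" "\<not> p islimpt derived S \<delta>"
    using assms by (auto simp: mem_derived_iff)
  then obtain U where U: "open U" "p \<in> U" "\<And>y. y \<in> derived S \<delta> \<Longrightarrow> y \<in> U \<Longrightarrow> y = p"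
    unfolding islimpt_def by blast
  show thesis
  proof (rule that[OF \<delta>(1)])
    show "open (U - {p})"
      using U(1) by (rule open_delete)
    then show "derived (S \<inter> (U - {p})) \<delta> = {}"
      using U(3) by (auto simp: derived_Int_open)
    fix D
    have "p islimpt (D \<inter> U) \<longleftrightarrow> p islimpt (D \<inter> (U - {p}))"
      unfolding islimpt_def by blast
    then show "p islimpt D \<longleftrightarrow> p islimpt (D \<inter> (U - {p}))"
      using islimpt_Int_open[OF U(1,2)] by blast
  qed simp
qed

text \<open>Let \<open>p \<in> A\<close> have rank \<open>natural_sum \<epsilon> \<eta>\<close> in
  the union. On a punctured neighbourhood of \<open>p\<close> the derivatives of \<open>A\<close>
  vanish at some \<open>\<delta> < \<epsilon>\<close>, so by induction those of the union vanish
  there at \<open>natural_sum \<delta> \<eta>\<close>. This is a smaller stage, at which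
  \<open>p\<close> should still be a limit point. The case \<open>p \<in> B\<close> is
  symmetric.\<close>

lemma derived_Un_empty:
  fixes A B :: "'b::t1_space set" and \<epsilon> \<eta> :: "'a::infinite ordinal"
  assumes "derived A \<epsilon> = {}" "derived B \<eta> = {}"
  shows "derived (A \<union> B) (natural_sum \<epsilon> \<eta>) = {}"
  using assms
proof (induction \<epsilon> arbitrary: A B \<eta> rule: less_induct)
  case outer: (less \<epsilon>)
  show ?case
    using outer.prems
  proof (induction \<eta> arbitrary: A B rule: less_induct)
    case (less \<eta>)
    have False if p: "p \<in> derived (A \<union> B) (natural_sum \<epsilon> \<eta>)" for p
    proof -
      have no: False if "\<rho> < natural_sum \<epsilon> \<eta>" "derived ((A \<union> B) \<inter> V) \<rho> = {}" "open V"
        "\<And>D. p islimpt D \<longleftrightarrow> p islimpt (D \<inter> V)" for \<rho> V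
        using p that by (metis derived_Int_open islimpt_EMPTY mem_derived_iff)
      have "p \<in> A \<or> p \<in> B"
        using p derived_subset by blast
      then show False
      proof
        assume "p \<in> A"
        then obtain \<delta> V where V: "\<delta> < \<epsilon>" "open V" "derived (A \<inter> V) \<delta> = {}"
          "\<And>D. p islimpt D \<longleftrightarrow> p islimpt (D \<inter> V)"
          using less.prems(1) not_mem_derivedE[of p A \<epsilon>] by (metis empty_iff)
        have "derived (B \<inter> V) \<eta> = {}"
          using less.prems(2) V(2) by (simp add: derived_Int_open)
        then have "derived ((A \<union> B) \<inter> V) (natural_sum \<delta> \<eta>) = {}"
          unfolding Int_Un_distrib2 by (rule outer.IH[OF V(1) V(3)])
        then show False
          using no V natural_sum_strict_mono_left by blast
      next
        assume "p \<in> B"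
        then obtain \<delta> V where V: "\<delta> < \<eta>" "open V" "derived (B \<inter> V) \<delta> = {}"
          "\<And>D. p islimpt D \<longleftrightarrow> p islimpt (D \<inter> V)"
          using less.prems(2) not_mem_derivedE[of p B \<eta>] by (metis empty_iff)
        have "derived (A \<inter> V) \<epsilon> = {}"
          using less.prems(1) V(2) by (simp add: derived_Int_open)
        then have "derived ((A \<union> B) \<inter> V) (natural_sum \<epsilon> \<delta>) = {}"
          unfolding Int_Un_distrib2 by (rule less.IH[OF V(1) _ V(3)])
        then show False
          using no V natural_sum_strict_mono_right by blast
      qed
    qed
    then show ?case
      by blast
  qed
qed

text \<open>This is stronger than having no point of rank \<open>\<beta>\<close>: for a limit
  \<open>\<beta>\<close>, the set \<open>{..<omega_pow \<beta>}\<close> has no such point, but its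
  ranks are unbounded in \<open>\<beta>\<close>.\<close>

definition thin :: "'a ordinal \<Rightarrow> 'b::topological_space set \<Rightarrow> bool"
  where "thin \<beta> B \<longleftrightarrow> (\<exists>\<epsilon><\<beta>. derived B \<epsilon> = {})"

lemma thin_subset: "thin \<beta> B \<Longrightarrow> A \<subseteq> B \<Longrightarrow> thin \<beta> A"
  unfolding thin_def by (metis derived_mono subset_empty)

lemma thin_Un:
  fixes A B :: "'b::t1_space set" and \<zeta> :: "'a::infinite ordinal"
  shows "thin (omega_pow \<zeta>) A \<Longrightarrow> thin (omega_pow \<zeta>) B \<Longrightarrow> thin (omega_pow \<zeta>) (A \<union> B)"
  unfolding thin_def by (metis derived_Un_empty natural_sum_less_omega_pow)

lemma thin_UN:
  fixes A :: "'c \<Rightarrow> 'b::t1_space set" and \<zeta> :: "'a::infinite ordinal"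
  assumes "finite I" "\<And>i. i \<in> I \<Longrightarrow> thin (omega_pow \<zeta>) (A i)"
  shows "thin (omega_pow \<zeta>) (\<Union>i\<in>I. A i)"
  using assms
proof (induction I)
  case empty
  have "thin (omega_pow \<zeta>) ({} :: 'b set)"
    unfolding thin_def by (rule exI[of _ 0]) simp
  then show ?case
    by simp
qed (simp add: thin_Un)

text \<open>Below rank \<open>omega_pow \<zeta> * \<delta>\<close>, compare \<open>S'\<close> and
  \<open>A'\<close>, the derivatives of \<open>S\<close> and \<open>S - B\<close> at an earlier
  multiple \<open>\<sigma>\<close>. By induction \<open>S' \<subseteq> A' \<union> B\<close>. If
  \<open>p\<close> had rank below \<open>omega_pow \<zeta>\<close> in \<open>A'\<close>, then on a
  punctured neighbourhood \<open>A'\<close>, and by \<open>thin_Un\<close> also \<open>S'\<close>,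
  would be thin, although \<open>p\<close> has rank \<open>omega_pow \<zeta>\<close> in
  \<open>S'\<close>.\<close>

lemma derived_Diff_thin:
  fixes S :: "'b::t1_space set" and \<zeta> :: "'a::infinite ordinal"
  assumes thin: "thin (omega_pow \<zeta>) B" and "p \<in> derived S (omega_pow \<zeta> * \<delta>)" "p \<notin> B"
  shows "p \<in> derived (S - B) (omega_pow \<zeta> * \<delta>)"
  using assms(2,3)
proof (induction \<delta> arbitrary: p rule: less_induct)
  case (less \<delta>)
  have "p islimpt derived (S - B) \<tau>" if \<tau>: "\<tau> < omega_pow \<zeta> * \<delta>" for \<tau>
  proof -
    obtain \<delta>' where \<delta>': "\<delta>' < \<delta>" "\<tau> < omega_pow \<zeta> * \<delta>' + omega_pow \<zeta>"
      using \<tau> by (rule less_times_ordinalE)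
    define \<sigma> where "\<sigma> = omega_pow \<zeta> * \<delta>'"
    \<comment> \<open>The induction hypothesis speaks of multiples of
      \<open>omega_pow \<zeta>\<close> only, so \<open>\<tau>\<close> is replaced by an offset from
      the multiple \<open>\<sigma>\<close>; the offset is 0 if
      \<open>\<tau> < \<sigma>\<close>.\<close>
    obtain \<epsilon> where \<epsilon>: "\<epsilon> < omega_pow \<zeta>" "\<tau> \<le> \<sigma> + \<epsilon>"
      using \<delta>'(2) unfolding \<sigma>_def[symmetric]
    proof (cases rule: less_plus_ordinalE)
      case 1
      then show ?thesis
        using that[of 0] by simp
    qed (use that in blast)
    define S' A' where "S' = derived S \<sigma>" and "A' = derived (S - B) \<sigma>"
    have sub: "S' \<subseteq> A' \<union> B"
      using less.IH[OF \<delta>'(1)] by (auto simp: S'_def A'_def \<sigma>_def)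
    have "\<sigma> + omega_pow \<zeta> \<le> omega_pow \<zeta> * \<delta>"
      unfolding \<sigma>_def by (rule times_ordinal_bound[OF \<delta>'(1)])
    then have p: "p \<in> derived S' (omega_pow \<zeta>)"
      using less.prems(1) derived_antimono unfolding S'_def derived_derived by blast
    have "p \<in> S'"
      using p derived_subset by blast
    then have "p \<in> A'"
      using sub less.prems(2) by blast
    have "p \<in> derived A' (omega_pow \<zeta>)"
    proof (rule ccontr)
      assume "\<not> ?thesis"
      with \<open>p \<in> A'\<close> obtain \<eta> V where V: "\<eta> < omega_pow \<zeta>" "open V" "derived (A' \<inter> V) \<eta> = {}"
        "\<And>D. p islimpt D \<longleftrightarrow> p islimpt (D \<inter> V)"
        using not_mem_derivedE[of p A' "omega_pow \<zeta>"] by metis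
      then have "thin (omega_pow \<zeta>) (A' \<inter> V)"
        unfolding thin_def by blast
      then have "thin (omega_pow \<zeta>) ((A' \<inter> V) \<union> B)"
        using thin by (rule thin_Un)
      then have "thin (omega_pow \<zeta>) (S' \<inter> V)"
        by (rule thin_subset) (use sub in blast)
      then obtain \<rho> where "\<rho> < omega_pow \<zeta>" "derived (S' \<inter> V) \<rho> = {}"
        unfolding thin_def by blast
      then show False
        using p V(2,4) by (metis derived_Int_open islimpt_EMPTY mem_derived_iff)
    qed
    then have "p islimpt derived (S - B) (\<sigma> + \<epsilon>)"
      using \<epsilon>(1) by (simp add: mem_derived_iff A'_def flip: derived_derived)
    then show ?thesis
      using islimpt_subset[OF _ derived_antimono[OF \<epsilon>(2)]] by blast
  qed
  moreover have "p \<in> S - B"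
    using less.prems derived_subset by blast
  ultimately show ?case
    by (meson mem_derived_iff)
qed

section \<open>Homogeneous sets\<close>

definition homogeneous :: "('b set \<Rightarrow> colour) \<Rightarrow> colour \<Rightarrow> 'b set \<Rightarrow> bool"
  where "homogeneous c C X \<longleftrightarrow> (\<forall>x\<in>X. \<forall>y\<in>X. x \<noteq> y \<longrightarrow> c {x, y} = C)"

lemma ball_nsets_2_iff: "(\<forall>e \<in> [X]\<^bsup>2\<^esup>. c e = C) \<longleftrightarrow> homogeneous c C X"
  by (auto simp: homogeneous_def nsets_2_eq)

lemma homogeneous_subset: "homogeneous c C X \<Longrightarrow> Y \<subseteq> X \<Longrightarrow> homogeneous c C Y"
  by (auto simp: homogeneous_def)

lemma homogeneous_empty [simp]: "homogeneous c C {}"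
  by (simp add: homogeneous_def)

lemma homogeneous_insert:
  "homogeneous c C (insert p X) \<longleftrightarrow> homogeneous c C X \<and> (\<forall>x\<in>X. x \<noteq> p \<longrightarrow> c {p, x} = C)"
  by (auto simp: homogeneous_def insert_commute)

lemma homogeneous_image:
  "inj_on h A \<Longrightarrow> homogeneous c C (h ` A) \<longleftrightarrow> homogeneous (\<lambda>e. c (h ` e)) C A"
  by (auto simp: homogeneous_def inj_on_def)

definition neighbours :: "('b set \<Rightarrow> colour) \<Rightarrow> 'b set \<Rightarrow> 'b \<Rightarrow> 'b set"
  where "neighbours c S p = {q \<in> S. q \<noteq> p \<and> c {p, q} = Blue}"

lemma blue_insert_neighbours:
  assumes "Y \<in> [neighbours c S p]\<^bsup>k\<^esup>" "homogeneous c Blue Y" "p \<in> S"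
  shows "insert p Y \<in> [S]\<^bsup>(Suc k)\<^esup>" "homogeneous c Blue (insert p Y)"
proof -
  have "p \<notin> Y" "Y \<subseteq> S"
    using assms(1) by (auto simp: nsets_def neighbours_def)
  then show "insert p Y \<in> [S]\<^bsup>(Suc k)\<^esup>"
    using assms by (simp add: nsets_def)
  show "homogeneous c Blue (insert p Y)"
    using assms(1,2) by (auto simp: homogeneous_insert nsets_def neighbours_def)
qed

text \<open>The case of blue sets of size 2, where both inductions on the blue size start.\<close>

lemma homogeneous_Red_or_blue_pair:
  "homogeneous c Red X \<or> (\<exists>Y\<in>[X]\<^bsup>2\<^esup>. homogeneous c Blue Y)"
proof (cases "homogeneous c Red X")
  case False
  then obtain x y where "x \<in> X" "y \<in> X" "x \<noteq> y" "c {x, y} = Blue"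
    unfolding homogeneous_def using colour.exhaust by blast
  then have "{x, y} \<in> [X]\<^bsup>2\<^esup>" "homogeneous c Blue {x, y}"
    by (auto simp: homogeneous_def insert_commute)
  then show ?thesis
    by blast
qed simp

definition finite_arrows :: "nat \<Rightarrow> nat \<Rightarrow> nat \<Rightarrow> bool"
  where "finite_arrows M m k \<longleftrightarrow>
    (\<forall>c. (\<exists>F \<in> [{..<M}]\<^bsup>m\<^esup>. homogeneous c Red F) \<or> (\<exists>Y \<in> [{..<M}]\<^bsup>k\<^esup>. homogeneous c Blue Y))"

lemma finite_arrowsD:
  assumes "finite_arrows M m k" "P \<in> [S]\<^bsup>M\<^esup>"
  shows "(\<exists>F \<in> [P]\<^bsup>m\<^esup>. homogeneous c Red F) \<or> (\<exists>Y \<in> [P]\<^bsup>k\<^esup>. homogeneous c Blue Y)"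
proof -
  have "finite P" "card P = M"
    using assms(2) by (simp_all add: nsets_def)
  then obtain h where h: "bij_betw h {..<M} P"
    using ex_bij_betw_nat_finite by (metis atLeast0LessThan)
  have *: "h ` A \<in> [P]\<^bsup>n\<^esup> \<and> homogeneous c C (h ` A)"
    if "A \<in> [{..<M}]\<^bsup>n\<^esup>" "homogeneous (\<lambda>e. c (h ` e)) C A" for A n C
  proof -
    have "A \<subseteq> {..<M}"
      using that(1) by (simp add: nsets_def)
    then have "inj_on h A" "h ` A \<subseteq> P"
      using h by (auto simp: bij_betw_def intro: inj_on_subset)
    then show ?thesis
      using that by (simp add: nsets_def card_image homogeneous_image)
  qed
  show ?thesis
    using assms(1) * unfolding finite_arrows_def by metis
qed

lemma ex_finite_arrows: "\<exists>M. finite_arrows M m k"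
proof -
  obtain r where r: "\<And>V E. finite (V :: nat set) \<Longrightarrow> r \<le> card V \<Longrightarrow>
      \<exists>R\<subseteq>V. card R = m \<and> clique R E \<or> card R = k \<and> indep R E"
    using ramsey2[of m k, where 'a = nat] by blast
  have "(\<exists>F \<in> [{..<r}]\<^bsup>m\<^esup>. homogeneous c Red F) \<or> (\<exists>Y \<in> [{..<r}]\<^bsup>k\<^esup>. homogeneous c Blue Y)" for c
  proof -
    obtain R where R: "R \<subseteq> {..<r}"
      "card R = m \<and> clique R {e. c e = Red} \<or> card R = k \<and> indep R {e. c e = Red}"
      using r[of "{..<r}" "{e. c e = Red}"] by auto
    have "finite R"
      using R(1) finite_subset by blast
    from R(2) show ?thesis
    proof
      assume "card R = m \<and> clique R {e. c e = Red}"
      then have "R \<in> [{..<r}]\<^bsup>m\<^esup> \<and> homogeneous c Red R"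
        using R(1) \<open>finite R\<close> by (auto simp: nsets_def clique_def homogeneous_def)
      then show ?thesis
        by blast
    next
      assume "card R = k \<and> indep R {e. c e = Red}"
      moreover have "C = Blue" if "C \<noteq> Red" for C
        using that by (cases C) simp_all
      ultimately have "R \<in> [{..<r}]\<^bsup>k\<^esup> \<and> homogeneous c Blue R"
        using R(1) \<open>finite R\<close> by (auto simp: nsets_def indep_def homogeneous_def)
      then show ?thesis
        by blast
    qed
  qed
  then show ?thesis
    unfolding finite_arrows_def by blast
qed

section \<open>Construction of red homogeneous sets\<close>

text \<open>Second countability relative to \<open>S\<close>: the whole type of ordinals has
  uncountably many isolated points and hence no countable base. Basic sets are open in the whole
  space, so the notion passes to subsets without change of base.\<close>

definition countably_based :: "'b::topological_space set \<Rightarrow> bool"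
  where "countably_based S \<longleftrightarrow> (\<exists>\<U>. countable \<U> \<and> (\<forall>U\<in>\<U>. open U) \<and>
    (\<forall>p\<in>S. \<forall>T. open T \<and> p \<in> T \<longrightarrow> (\<exists>U\<in>\<U>. p \<in> U \<and> U \<subseteq> T)))"

lemma countably_based_subset: "countably_based S \<Longrightarrow> T \<subseteq> S \<Longrightarrow> countably_based T"
  unfolding countably_based_def by (metis subsetD)

text \<open>Tasks must recur, since a point that a task concerns may be chosen arbitrarily late. The
  index encodes a pair, whose first component selects the value and whose second makes the index
  large.\<close>

lemma frequent_enumeration:
  assumes "countable T"
  shows "\<exists>t :: nat \<Rightarrow> 'c. \<forall>u\<in>T. \<forall>N. \<exists>n\<ge>N. t n = u"
proof -
  have "\<exists>n\<ge>N. from_nat_into T (fst (prod_decode n)) = u" if u: "u \<in> T" for u N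
  proof -
    obtain m where "from_nat_into T m = u"
      using from_nat_into_surj[OF assms u] by blast
    then show ?thesis
      by (intro exI[of _ "prod_encode (m, N)"]) (simp add: le_prod_encode_2)
  qed
  then show ?thesis
    by (intro exI[of _ "\<lambda>n. from_nat_into T (fst (prod_decode n))"]) simp
qed

text \<open>A task \<open>(U, \<delta>)\<close> asks for a new point of \<open>U\<close> that has
  rank \<open>omega_pow \<zeta> * \<delta>\<close> in \<open>S\<close> and is red to all points
  chosen so far. The last two conclusions serve the two goals: chosen points, in particular those of
  \<open>F0\<close>, keep their rank divided by \<open>omega_pow \<zeta>\<close>; and without any
  prescribed point, the tasks with \<open>U = UNIV\<close> make the ranks of \<open>X\<close>
  large.\<close>

lemma ex_red_homogeneous:
  fixes S :: "'b::t1_space set" and \<zeta> \<gamma> :: "'a::infinite ordinal"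
  assumes based: "countably_based S" and countable: "countable {..<\<gamma>}" and "0 < \<zeta>"
    and thin: "\<And>p. p \<in> S \<Longrightarrow> thin (omega_pow \<zeta>) (neighbours c S p)"
    and F0: "finite F0" "F0 \<subseteq> S" "homogeneous c Red F0"
  obtains X where "F0 \<subseteq> X" "X \<subseteq> S" "homogeneous c Red X"
    "\<And>p \<tau>. \<tau> \<le> \<gamma> \<Longrightarrow> p \<in> X \<Longrightarrow> p \<in> derived S (omega_pow \<zeta> * \<tau>) \<Longrightarrow> p \<in> derived X \<tau>"
    "\<And>\<delta>. \<delta> < \<gamma> \<Longrightarrow> derived S (omega_pow \<zeta> * (\<delta> + 1)) \<noteq> {} \<Longrightarrow> derived X \<delta> \<noteq> {}"
proof -
  define D where "D \<delta> = derived S (omega_pow \<zeta> * \<delta>)" for \<delta>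
  obtain \<U> where "countable \<U> \<and> (\<forall>U\<in>\<U>. open U) \<and>
      (\<forall>p\<in>S. \<forall>T. open T \<and> p \<in> T \<longrightarrow> (\<exists>U\<in>\<U>. p \<in> U \<and> U \<subseteq> T))"
    using based unfolding countably_based_def ..
  then have \<U>: "countable \<U>" "\<And>U. U \<in> \<U> \<Longrightarrow> open U"
    "\<And>p T. p \<in> S \<Longrightarrow> open T \<Longrightarrow> p \<in> T \<Longrightarrow> \<exists>U\<in>\<U>. p \<in> U \<and> U \<subseteq> T"
    by simp_all
  have "countable (insert UNIV \<U> \<times> {..<\<gamma>})"
    by (intro countable_SIGMA countable_insert \<U>(1) countable)
  from frequent_enumeration[OF this]
  obtain task :: "nat \<Rightarrow> _" where task: "\<And>u N. u \<in> insert UNIV \<U> \<times> {..<\<gamma>} \<Longrightarrow> \<exists>n\<ge>N. task n = u"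
    by blast
  define suitable where "suitable F u q \<longleftrightarrow>
    q \<in> fst u \<inter> D (snd u) \<and> q \<notin> F \<and> homogeneous c Red (insert q F)" for F u q
  \<comment> \<open>A task without a candidate is skipped, so the recursion is total;
    \<open>served\<close> covers the tasks that matter.\<close>
  define step where "step u F = (if \<exists>q. suitable F u q then insert (SOME q. suitable F u q) F else F)"
    for F u
  define G where "G = rec_nat F0 (\<lambda>n. step (task n))"
  have G_simps: "G 0 = F0" "G (Suc n) = step (task n) (G n)" for n
    by (simp_all add: G_def)
  have step_suitable: "\<exists>q. suitable F u q \<and> step u F = insert q F" if "\<exists>q. suitable F u q" for F u
    unfolding step_def using that by (metis someI_ex)
  have D_sub: "D \<delta> \<subseteq> S" for \<delta>
    unfolding D_def by (rule derived_subset)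
  have G: "finite (G n) \<and> G n \<subseteq> S \<and> homogeneous c Red (G n)" for n
  proof (induction n)
    case (Suc n)
    show ?case
    proof (cases "\<exists>q. suitable (G n) (task n) q")
      case True
      then obtain q where "suitable (G n) (task n) q" "G (Suc n) = insert q (G n)"
        using step_suitable unfolding G_simps by blast
      then show ?thesis
        using Suc D_sub by (auto simp: suitable_def)
    next
      case False
      then show ?thesis
        using Suc by (simp add: G_simps step_def)
    qed
  qed (simp add: G_simps F0)
  have mono: "G m \<subseteq> G n" if "m \<le> n" for m n
    using that by (rule lift_Suc_mono_le[rotated]) (auto simp: G_simps step_def)
  define X where "X = (\<Union>n. G n)"
  \<comment> \<open>If candidates exist at all stages from \<open>N\<close> on, the next occurrence
    of the task takes one; being new at that stage, it is not in \<open>G N\<close>.\<close>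
  have served: "\<exists>q\<in>X. q \<in> U \<inter> D \<delta> \<and> q \<notin> G N"
    if U: "U \<in> insert UNIV \<U>" and \<delta>: "\<delta> < \<gamma>"
      and ex: "\<And>n. N \<le> n \<Longrightarrow> \<exists>q. suitable (G n) (U, \<delta>) q" for U \<delta> N
  proof -
    obtain n where n: "N \<le> n" "task n = (U, \<delta>)"
      using task[of "(U, \<delta>)" N] U \<delta> by blast
    obtain q where "suitable (G n) (U, \<delta>) q" "G (Suc n) = insert q (G n)"
      using step_suitable[OF ex[OF n(1)]] unfolding G_simps n(2) by blast
    then show ?thesis
      using mono[OF n(1)] unfolding X_def suitable_def by (metis UN_I UNIV_I fst_conv snd_conv insertI1 subsetD)
  qed
  \<comment> \<open>A point of \<open>S\<close> outside \<open>G n\<close> and \<open>B n\<close> is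
    red to all of \<open>G n\<close>, and \<open>B n\<close> is a finite union of thin sets.\<close>
  define B where "B n = (\<Union>x\<in>G n. neighbours c S x)" for n
  have thin_B: "thin (omega_pow \<zeta>) (B n)" for n
    unfolding B_def using G thin by (intro thin_UN) auto
  have suitableI: "suitable (G n) (U, \<delta>) q" if "q \<in> U \<inter> D \<delta>" "q \<notin> G n" "q \<notin> B n" for n U \<delta> q
    using that G[of n] D_sub[of \<delta>]
    by (auto simp: suitable_def homogeneous_insert B_def neighbours_def insert_commute)
      (metis colour.exhaust insert_commute subsetD)
  have near: "p \<in> derived X \<tau>" if "\<tau> \<le> \<gamma>" "p \<in> X" "p \<in> D \<tau>" for p \<tau>
    using that
  proof (induction \<tau> arbitrary: p rule: less_induct)
    case (less \<tau>)
    obtain N where N: "p \<in> G N"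
      using less.prems(2) by (auto simp: X_def)
    have "p islimpt derived X \<delta>" if \<delta>: "\<delta> < \<tau>" for \<delta>
    proof (rule islimptI)
      fix T assume T: "p \<in> T" "open T"
      then obtain U where U: "U \<in> \<U>" "p \<in> U" "U \<subseteq> T"
        using \<U>(3) less.prems(3) D_sub by blast
      have "\<exists>q. suitable (G n) (U, \<delta>) q" if n: "N \<le> n" for n
      proof -
        have pn: "p \<in> G n"
          using N mono[OF n] by blast
        \<comment> \<open>All edges from \<open>p\<close> within \<open>G n\<close> are red, so
          \<open>p\<close> survives the removal of \<open>B n\<close> and retains its rank.\<close>
        then have "p \<notin> B n"
          using G[of n] by (auto simp: B_def neighbours_def homogeneous_def)
        then have "p \<in> derived (S - B n) (omega_pow \<zeta> * \<tau>)"
          using derived_Diff_thin[OF thin_B] less.prems(3) by (simp add: D_def)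
        then have lim: "p islimpt derived (S - B n) (omega_pow \<zeta> * \<delta>)"
          using times_ordinal_strict_mono[OF omega_pow_pos \<delta>] by (simp add: mem_derived_iff)
        \<comment> \<open>Avoiding the finitely many other chosen points makes the point found near
          \<open>p\<close> a new one.\<close>
        have "open (U - (G n - {p}))"
          using \<U>(2)[OF U(1)] G[of n] by (intro open_Diff finite_imp_closed) auto
        then obtain q where q: "q \<in> derived (S - B n) (omega_pow \<zeta> * \<delta>)" "q \<in> U - (G n - {p})" "q \<noteq> p"
          using islimptE[OF lim, of "U - (G n - {p})"] U(2) by blast
        have "q \<in> D \<delta>"
          using q(1) derived_mono[of "S - B n" S] unfolding D_def by blast
        moreover have "q \<notin> B n"
          using q(1) derived_subset by blast
        ultimately show ?thesis
          using suitableI q(2,3) by blast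
      qed
      then obtain q where q: "q \<in> X" "q \<in> U \<inter> D \<delta>" "q \<notin> G N"
        using served[of U \<delta> N] U(1) \<delta> less.prems(1) by (meson insertI2 less_le_trans)
      then have "q \<in> derived X \<delta>"
        using less.IH[OF \<delta>] \<delta> less.prems(1) by (simp add: le_less_trans less_imp_le)
      then show "\<exists>y\<in>derived X \<delta>. y \<in> T \<and> y \<noteq> p"
        using q U(3) N by blast
    qed
    then show ?case
      using less.prems(2) by (meson mem_derived_iff)
  qed
  have far: "derived X \<delta> \<noteq> {}" if \<delta>: "\<delta> < \<gamma>" and ne: "D (\<delta> + 1) \<noteq> {}" for \<delta>
  proof -
    \<comment> \<open>A point of rank \<open>omega_pow \<zeta>\<close> in \<open>D \<delta>\<close>
      shows that \<open>D \<delta>\<close> is not thin, so the thin set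
      \<open>G n \<union> B n\<close> does not cover it. That the finite set \<open>G n\<close> is
      thin uses \<open>0 < \<zeta>\<close>.\<close>
    have "\<exists>q. suitable (G n) (UNIV, \<delta>) q" for n
    proof -
      have "derived (G n) (1 :: 'a ordinal) = {}"
        using islimpt_finite[of "G n"] G[of n] by (auto simp: mem_derived_iff)
      moreover have "1 < omega_pow \<zeta>"
        using omega_pow_strict_mono[OF \<open>0 < \<zeta>\<close>] by simp
      ultimately have "thin (omega_pow \<zeta>) (G n)"
        unfolding thin_def by blast
      then have "thin (omega_pow \<zeta>) (G n \<union> B n)"
        using thin_B by (rule thin_Un)
      moreover have "\<not> thin (omega_pow \<zeta>) (D \<delta>)"
        using ne derived_antimono[of _ "omega_pow \<zeta>" "D \<delta>"] less_imp_le
        unfolding thin_def D_def derived_derived times_plus_one_ordinal by (metis subset_empty)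
      ultimately have "\<not> D \<delta> \<subseteq> G n \<union> B n"
        using thin_subset by blast
      then show ?thesis
        using suitableI[of _ UNIV \<delta> n] by blast
    qed
    then obtain q where "q \<in> X" "q \<in> D \<delta>"
      using served[of UNIV \<delta> 0] \<delta> by blast
    then show ?thesis
      using near[OF less_imp_le[OF \<delta>]] by blast
  qed
  show thesis
  proof (rule that)
    show "F0 \<subseteq> X"
      using G_simps(1) by (auto simp: X_def)
    show "X \<subseteq> S"
      using G by (auto simp: X_def)
    show "homogeneous c Red X"
      unfolding homogeneous_def
    proof (intro ballI impI)
      fix x y assume "x \<in> X" "y \<in> X" "x \<noteq> y"
      then obtain i j where "x \<in> G i" "y \<in> G j"
        by (auto simp: X_def)
      then have "x \<in> G (max i j)" "y \<in> G (max i j)"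
        using mono[of i "max i j"] mono[of j "max i j"] by auto
      then show "c {x, y} = Red"
        using G[of "max i j"] \<open>x \<noteq> y\<close> by (auto simp: homogeneous_def)
    qed
  qed (use near far in \<open>simp_all add: D_def\<close>)
qed

section \<open>Partition relations in terms of derivatives\<close>

lemma times_omega_pow_omega_pow:
  fixes \<alpha> :: "'a::infinite ordinal"
  shows "omega_pow (\<alpha> * ord_of_nat k) * omega_pow \<alpha> = omega_pow (\<alpha> * ord_of_nat (Suc k))"
  by (simp add: times_plus_one_ordinal omega_pow_plus)

text \<open>In the step, \<open>omega_pow \<zeta>\<close> with
  \<open>\<zeta> = \<alpha> * ord_of_nat (Suc k)\<close> is exactly the threshold of the induction
  hypothesis. To leave ranks unbounded in \<open>omega_pow \<alpha>\<close> after division by it,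
  the new threshold is \<open>omega_pow \<zeta> * omega_pow \<alpha>\<close>: one more
  \<open>\<alpha>\<close> in the exponent per blue point.\<close>

lemma partition_not_thin:
  fixes S :: "'b::t1_space set" and \<alpha> :: "'a::infinite ordinal"
  assumes "countable {..<\<alpha>}" "0 < \<alpha>" "countably_based S"
    "\<not> thin (omega_pow (\<alpha> * ord_of_nat (Suc k))) S"
  shows "(\<exists>X\<subseteq>S. homogeneous c Red X \<and> \<not> thin (omega_pow \<alpha>) X) \<or>
    (\<exists>Y\<in>[S]\<^bsup>(k + 2)\<^esup>. homogeneous c Blue Y)"
  using assms(3,4)
proof (induction k arbitrary: S)
  case 0
  then have "\<not> thin (omega_pow \<alpha>) S"
    by simp
  then show ?case
    using homogeneous_Red_or_blue_pair[of c S] unfolding add_0 by blast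
next
  case (Suc k)
  define \<zeta> where "\<zeta> = \<alpha> * ord_of_nat (Suc k)"
  show ?case
  proof (cases "\<exists>p\<in>S. \<not> thin (omega_pow \<zeta>) (neighbours c S p)")
    case True
    then obtain p where p: "p \<in> S" "\<not> thin (omega_pow \<zeta>) (neighbours c S p)"
      by blast
    have sub: "neighbours c S p \<subseteq> S"
      by (auto simp: neighbours_def)
    then have "(\<exists>X\<subseteq>neighbours c S p. homogeneous c Red X \<and> \<not> thin (omega_pow \<alpha>) X) \<or>
        (\<exists>Y\<in>[neighbours c S p]\<^bsup>(k + 2)\<^esup>. homogeneous c Blue Y)"
      using Suc.IH Suc.prems(1) p(2) countably_based_subset unfolding \<zeta>_def by blast
    then show ?thesis
      using blue_insert_neighbours[OF _ _ p(1)] sub by (metis add_Suc subset_trans)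
  next
    case False
    have "0 < \<zeta>"
      unfolding \<zeta>_def ord_of_nat.simps times_plus_one_ordinal
      using assms(2) le_plus_ordinal_right less_le_trans by blast
    have thin: "thin (omega_pow \<zeta>) (neighbours c S p)" if "p \<in> S" for p
      using False that by blast
    obtain X where X: "X \<subseteq> S" "homogeneous c Red X"
      "\<And>\<delta>. \<delta> < omega_pow \<alpha> \<Longrightarrow> derived S (omega_pow \<zeta> * (\<delta> + 1)) \<noteq> {} \<Longrightarrow> derived X \<delta> \<noteq> {}"
      using ex_red_homogeneous[OF Suc.prems(1) countable_lessThan_omega_pow[OF assms(1)] \<open>0 < \<zeta>\<close>
          thin finite.emptyI empty_subsetI homogeneous_empty] by metis
    \<comment> \<open>Rank \<open>\<delta>\<close> in \<open>X\<close> costs rank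
      \<open>omega_pow \<zeta> * (\<delta> + 1)\<close> in \<open>S\<close>; the extra 1 is harmless
      because \<open>omega_pow \<alpha>\<close> is a limit.\<close>
    have "derived S (omega_pow \<zeta> * (\<delta> + 1)) \<noteq> {}" if "\<delta> < omega_pow \<alpha>" for \<delta>
    proof -
      have "\<delta> + 1 < omega_pow \<alpha>"
        using limit_ordinal_omega_pow[OF assms(2)] that by (simp add: limit_ordinal_def)
      then have "omega_pow \<zeta> * (\<delta> + 1) < omega_pow \<zeta> * omega_pow \<alpha>"
        by (rule times_ordinal_strict_mono[OF omega_pow_pos])
      then show ?thesis
        using Suc.prems(2) unfolding thin_def \<zeta>_def times_omega_pow_omega_pow by blast
    qed
    then have "\<not> thin (omega_pow \<alpha>) X"
      using X(3) unfolding thin_def by blast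
    then show ?thesis
      using X by blast
  qed
qed

text \<open>A single point of rank \<open>\<eta> + 1\<close> is a limit of points of rank
  \<open>\<eta>\<close>, so there are infinitely many of these.\<close>

lemma ex_nsets_derived_of_not_thin:
  fixes S :: "'b::t1_space set" and \<eta> \<zeta> :: "'a::infinite ordinal"
  assumes "\<eta> < omega_pow \<zeta>" "0 < \<zeta>" "\<not> thin (omega_pow \<zeta>) S"
  shows "\<exists>P. P \<in> [derived S \<eta>]\<^bsup>M\<^esup>"
proof -
  have "\<eta> + 1 < omega_pow \<zeta>"
    using limit_ordinal_omega_pow[OF assms(2)] assms(1) by (simp add: limit_ordinal_def)
  then obtain p where "p \<in> derived S (\<eta> + 1)"
    using assms(3) unfolding thin_def by blast
  then have "p islimpt derived S \<eta>"
    by (simp add: mem_derived_iff less_plus_one_ordinal_iff)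
  then have "infinite (derived S \<eta>)"
    using islimpt_finite by blast
  then show ?thesis
    using infinite_arbitrarily_large[of "derived S \<eta>" M] by (auto simp: nsets_def)
qed

text \<open>
  The strict inequality \<open>e k < omega_pow (\<zeta> k)\<close> is needed because a set without points of rank
  \<open>e k\<close> may still have ranks unbounded in \<open>e k\<close>.  This causes the summand 1 in
  \<open>tower_exponent\<close> below, which is absorbed exactly if \<open>\<alpha>\<close> is infinite.
\<close>

lemma partition_nsets_derived:
  fixes S :: "'b::t1_space set" and \<nu> :: "'a::infinite ordinal"
  assumes "countable {..<\<nu>}" and e: "e 0 = \<nu>" "\<And>k. e (Suc k) = omega_pow (\<zeta> k) * \<nu>"
    and \<zeta>: "\<And>k. 0 < \<zeta> k" "\<And>k. e k < omega_pow (\<zeta> k)"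
    and "countably_based S" "finite_arrows M m (k + 2)" "P \<in> [derived S (e k)]\<^bsup>M\<^esup>"
  shows "(\<exists>X\<subseteq>S. homogeneous c Red X \<and> (\<exists>F. F \<in> [derived X \<nu>]\<^bsup>m\<^esup>)) \<or>
    (\<exists>Y\<in>[S]\<^bsup>(k + 2)\<^esup>. homogeneous c Blue Y)"
  using assms(6-)
proof (induction k arbitrary: S M P)
  case 0
  have "[P]\<^bsup>m\<^esup> \<subseteq> [derived S \<nu>]\<^bsup>m\<^esup>" "[P]\<^bsup>2\<^esup> \<subseteq> [S]\<^bsup>2\<^esup>"
    using 0 e(1) derived_subset[of S] by (auto simp: nsets_def)
  then show ?case
    using homogeneous_Red_or_blue_pair[of c S] finite_arrowsD[OF 0(2,3), of c]
    unfolding add_0 by blast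
next
  case (Suc k)
  have sub: "neighbours c S p \<subseteq> S" for p
    by (auto simp: neighbours_def)
  show ?case
  proof (cases "\<exists>p\<in>S. \<not> thin (omega_pow (\<zeta> k)) (neighbours c S p)")
    case True
    then obtain p where p: "p \<in> S" "\<not> thin (omega_pow (\<zeta> k)) (neighbours c S p)"
      by blast
    \<comment> \<open>The size \<open>M'\<close> is unrelated to \<open>M\<close>: the neighbourhood
      has arbitrarily many points of rank \<open>e k\<close>.\<close>
    obtain M' where M': "finite_arrows M' m (k + 2)"
      using ex_finite_arrows by blast
    obtain P' where "P' \<in> [derived (neighbours c S p) (e k)]\<^bsup>M'\<^esup>"
      using ex_nsets_derived_of_not_thin[OF \<zeta>(2) \<zeta>(1) p(2)] by blast
    then have "(\<exists>X\<subseteq>neighbours c S p. homogeneous c Red X \<and> (\<exists>F. F \<in> [derived X \<nu>]\<^bsup>m\<^esup>)) \<or>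
        (\<exists>Y\<in>[neighbours c S p]\<^bsup>(k + 2)\<^esup>. homogeneous c Blue Y)"
      using Suc.IH[OF _ M'] countably_based_subset[OF Suc.prems(1) sub] by blast
    then show ?thesis
      using blue_insert_neighbours[OF _ _ p(1)] sub by (metis add_Suc subset_trans)
  next
    case False
    have thin: "thin (omega_pow (\<zeta> k)) (neighbours c S p)" if "p \<in> S" for p
      using False that by blast
    have P: "P \<subseteq> derived S (omega_pow (\<zeta> k) * \<nu>)"
      using Suc.prems(3) by (simp add: nsets_def e)
    \<comment> \<open>Finite Ramsey is applied to the points of full rank first. A red
      \<open>F\<close> then starts the construction, so all its points have rank
      \<open>\<nu>\<close> in one red set.\<close>
    have "[P]\<^bsup>(Suc k + 2)\<^esup> \<subseteq> [S]\<^bsup>(Suc k + 2)\<^esup>"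
      using P derived_subset by (intro nsets_mono) blast
    then consider Y where "Y \<in> [S]\<^bsup>(Suc k + 2)\<^esup>" "homogeneous c Blue Y"
      | F where "F \<in> [P]\<^bsup>m\<^esup>" "homogeneous c Red F"
      using finite_arrowsD[OF Suc.prems(2,3), of c] by blast
    then show ?thesis
    proof cases
      case 2
      have F: "finite F" "F \<subseteq> derived S (omega_pow (\<zeta> k) * \<nu>)"
        using 2(1) P by (auto simp: nsets_def)
      obtain X where X: "F \<subseteq> X" "X \<subseteq> S" "homogeneous c Red X"
        "\<And>p. p \<in> X \<Longrightarrow> p \<in> derived S (omega_pow (\<zeta> k) * \<nu>) \<Longrightarrow> p \<in> derived X \<nu>"
        using ex_red_homogeneous[OF Suc.prems(1) assms(1) \<zeta>(1)[of k] thin F(1)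
            subset_trans[OF F(2) derived_subset] 2(2)] by (metis order_refl)
      then have "F \<subseteq> derived X \<nu>"
        using F(2) by blast
      then have "F \<in> [derived X \<nu>]\<^bsup>m\<^esup>"
        using 2(1) by (simp add: nsets_def)
      then show ?thesis
        using X by blast
    qed blast
  qed
qed

section \<open>Derivatives in the order topology\<close>

lemma lessThan_plus_one_ordinal: "{..<p + 1} = {..p :: 'a::infinite ordinal}"
  by (auto simp: less_plus_one_ordinal_iff)

lemma open_atMost_ordinal: "open {..p :: 'a::infinite ordinal}"
  using open_lessThan[of "p + 1"] by (simp only: lessThan_plus_one_ordinal)

lemma open_greaterThanAtMost_ordinal: "open {b<..p :: 'a::infinite ordinal}"
proof -
  have "{b<..p} = {b<..} \<inter> {..p}"
    by auto
  then show ?thesis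
    using open_Int[OF open_greaterThan open_atMost_ordinal] by metis
qed

lemma open_ordinalE:
  fixes p :: "'a::infinite ordinal"
  assumes "open T" "p \<in> T"
  obtains "p = 0" | b where "b < p" "{b<..p} \<subseteq> T"
proof (cases "p = 0")
  case False
  then have "0 < p"
    by (simp add: less_le)
  then show thesis
    using that(2) open_left[OF assms] by metis
qed

lemma islimpt_ordinal_iff:
  fixes p :: "'a::infinite ordinal"
  shows "p islimpt D \<longleftrightarrow> 0 < p \<and> (\<forall>b<p. \<exists>q\<in>D. b < q \<and> q < p)"
proof
  assume lim: "p islimpt D"
  have "0 < p"
  proof (rule ccontr)
    assume "\<not> 0 < p"
    then have p: "p = 0"
      by (simp add: less_le)
    obtain y where "y \<in> {..p}" "y \<noteq> p"
      using islimptE[OF lim _ open_atMost_ordinal[of p]] by auto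
    then show False
      using antisym[OF _ zero_le_ordinal] by (simp add: p)
  qed
  moreover have "\<exists>q\<in>D. b < q \<and> q < p" if "b < p" for b
  proof -
    have "p \<in> {b<..p}"
      using that by simp
    then obtain y where "y \<in> D" "y \<in> {b<..p}" "y \<noteq> p"
      using islimptE[OF lim _ open_greaterThanAtMost_ordinal] by metis
    then show ?thesis
      by (intro bexI[of _ y]) auto
  qed
  ultimately show "0 < p \<and> (\<forall>b<p. \<exists>q\<in>D. b < q \<and> q < p)"
    by simp
next
  assume R: "0 < p \<and> (\<forall>b<p. \<exists>q\<in>D. b < q \<and> q < p)"
  show "p islimpt D"
  proof (rule islimptI)
    fix T assume "p \<in> T" "open T"
    from this(2,1) show "\<exists>y\<in>D. y \<in> T \<and> y \<noteq> p"
    proof (cases rule: open_ordinalE)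
      case (2 b)
      then obtain q where "q \<in> D" "b < q" "q < p"
        using R by metis
      then show ?thesis
        using 2(2) by (intro bexI[of _ q]) auto
    qed (use R in simp)
  qed
qed

lemma countably_based_lessThan_ordinal:
  assumes "countable {..<\<Omega> :: 'a::infinite ordinal}"
  shows "countably_based {..<\<Omega>}"
proof -
  define \<U> where "\<U> = insert {..0} ((\<lambda>(b, p). {b<..p}) ` ({..<\<Omega>} \<times> {..<\<Omega>}))"
  have "countable \<U>"
    unfolding \<U>_def using assms by (intro countable_insert countable_image countable_SIGMA) auto
  moreover have "open U" if "U \<in> \<U>" for U
    using that by (auto simp: \<U>_def open_greaterThanAtMost_ordinal open_atMost_ordinal)
  moreover have "\<exists>U\<in>\<U>. p \<in> U \<and> U \<subseteq> T" if p: "p < \<Omega>" and T: "open T" "p \<in> T" for p T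
    using T
  proof (cases rule: open_ordinalE)
    case 1
    then have "{..0} \<subseteq> T"
      using T(2) by auto
    then show ?thesis
      using 1 by (auto simp: \<U>_def)
  next
    case (2 b)
    then have "{b<..p} \<in> \<U>"
      using p by (auto simp: \<U>_def intro: less_trans)
    then show ?thesis
      using 2 by (intro bexI[of _ "{b<..p}"]) auto
  qed
  ultimately show ?thesis
    unfolding countably_based_def by (intro exI[of _ \<U>]) auto
qed

text \<open>Injectivity keeps images of nearby points different from \<open>f p\<close>. One
  inclusion suffices, since it applies to both maps of a homeomorphism.\<close>

lemma derived_image_subset:
  fixes f :: "'b::topological_space \<Rightarrow> 'c::topological_space"
  assumes "continuous_on X f" "inj_on f X"
  shows "f ` derived X \<gamma> \<subseteq> derived (f ` X) \<gamma>"
proof (induction \<gamma> rule: less_induct)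
  case (less \<gamma>)
  have "f p \<in> derived (f ` X) \<gamma>" if p: "p \<in> derived X \<gamma>" for p
  proof -
    have "p \<in> X"
      using p derived_subset by blast
    have "f p islimpt derived (f ` X) \<delta>" if \<delta>: "\<delta> < \<gamma>" for \<delta>
    proof (rule islimptI)
      fix T assume T: "f p \<in> T" "open T"
      then obtain A where A: "open A" "p \<in> A" "\<And>y. y \<in> X \<Longrightarrow> y \<in> A \<Longrightarrow> f y \<in> T"
        using assms(1) \<open>p \<in> X\<close> unfolding continuous_on_topological by metis
      have "p islimpt derived X \<delta>"
        using p \<delta> by (simp add: mem_derived_iff)
      then obtain q where q: "q \<in> derived X \<delta>" "q \<in> A" "q \<noteq> p"
        using A(1,2) by (metis islimptE)
      then have "q \<in> X"
        using derived_subset by blast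
      then have "f q \<noteq> f p" "f q \<in> T"
        using q A(3) \<open>p \<in> X\<close> assms(2) by (auto dest: inj_onD)
      then show "\<exists>y\<in>derived (f ` X) \<delta>. y \<in> T \<and> y \<noteq> f p"
        using less.IH[OF \<delta>] q(1) by blast
    qed
    then show ?thesis
      using \<open>p \<in> X\<close> by (simp add: mem_derived_iff)
  qed
  then show ?case
    by blast
qed

section \<open>Ranks of ordinals and powers of omega\<close>

lemma derived_pos:
  fixes \<xi> :: "'a::infinite ordinal"
  assumes "\<xi> \<in> derived S \<gamma>" "0 < \<gamma>"
  shows "0 < \<xi>"
proof -
  have "\<xi> islimpt S"
    using assms by (metis derived_zero mem_derived_iff)
  then show ?thesis
    by (simp add: islimpt_ordinal_iff)
qed

lemma mem_derived_ordinalI: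
  fixes p :: "'a::infinite ordinal"
  assumes "p \<in> S" "0 < p"
    and "\<And>\<delta> b. \<delta> < \<gamma> \<Longrightarrow> b < p \<Longrightarrow> \<exists>q\<in>derived S \<delta>. b < q \<and> q < p"
  shows "p \<in> derived S \<gamma>"
  unfolding mem_derived_iff[of p] islimpt_ordinal_iff using assms by blast

text \<open>Every ordinal from \<open>r\<close> on is \<open>r + q'\<close>, so the points
  approaching \<open>r + \<xi>\<close> translate back. For \<open>\<xi> = 0\<close> this fails:
  \<open>r\<close> may have any rank, but 0 is isolated.\<close>

lemma derived_translate:
  fixes r \<xi> \<gamma> :: "'a::infinite ordinal"
  assumes "r + \<xi> \<in> derived UNIV \<gamma>" "0 < \<xi>"
  shows "\<xi> \<in> derived UNIV \<gamma>"
  using assms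
proof (induction \<gamma> arbitrary: \<xi> rule: less_induct)
  case (less \<gamma>)
  have "\<exists>q\<in>derived UNIV \<delta>. b < q \<and> q < \<xi>" if \<delta>: "\<delta> < \<gamma>" and b: "b < \<xi>" for \<delta> b
  proof -
    have "r + \<xi> islimpt derived UNIV \<delta>"
      using less.prems(1) \<delta> by (simp add: mem_derived_iff)
    then obtain q where q: "q \<in> derived UNIV \<delta>" "r + b < q" "q < r + \<xi>"
      using plus_ordinal_strict_mono[OF b] unfolding islimpt_ordinal_iff by metis
    have "r \<le> q"
      using le_plus_ordinal[of r b] q(2) by simp
    then obtain q' where q': "q = r + q'"
      by (rule le_ordinalE)
    then have "b < q'" "q' < \<xi>"
      using q by (simp_all add: plus_ordinal_less_iff)
    moreover have "q' \<in> derived UNIV \<delta>"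
      using less.IH[OF \<delta>] q(1) q' le_less_trans[OF zero_le_ordinal \<open>b < q'\<close>] by simp
    ultimately show ?thesis
      by blast
  qed
  then show ?case
    using less.prems(2) by (intro mem_derived_ordinalI) simp_all
qed

text \<open>Successive points of \<open>F\<close> differ by a positive ordinal of rank
  \<open>\<gamma>\<close>, hence by at least \<open>omega_pow \<gamma>\<close>. The one-point case
  is a hypothesis because its own proof by induction calls this lemma for smaller ranks.\<close>

lemma omega_pow_times_card_le:
  fixes \<gamma> \<xi> :: "'a::infinite ordinal"
  assumes single: "\<And>\<xi>. \<xi> \<in> derived UNIV \<gamma> \<Longrightarrow> 0 < \<xi> \<Longrightarrow> omega_pow \<gamma> \<le> \<xi>"
    and "finite F" "F \<subseteq> derived UNIV \<gamma>" "F \<subseteq> {0<..\<xi>}"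
  shows "omega_pow \<gamma> * ord_of_nat (card F) \<le> \<xi>"
  using assms(2-)
proof (induction F arbitrary: \<xi> rule: finite_linorder_max_induct)
  case (insert p F)
  \<comment> \<open>The previous point of \<open>F\<close>, or 0 at the start.\<close>
  define r where "r = (if F = {} then 0 else Max F)"
  have r: "F \<subseteq> {0<..r}" "r < p"
    using insert by (auto simp: r_def)
  then obtain \<xi>' where \<xi>': "p = r + \<xi>'"
    using le_ordinalE less_imp_le by metis
  then have "0 < \<xi>'"
    using r(2) plus_ordinal_less_iff[of r 0 \<xi>'] by simp
  then have "omega_pow \<gamma> \<le> \<xi>'"
    using insert.prems(1) derived_translate single \<xi>' by blast
  have "p \<notin> F"
    using insert.hyps(2) by blast
  then have "omega_pow \<gamma> * ord_of_nat (card (insert p F))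
      = omega_pow \<gamma> * ord_of_nat (card F) + omega_pow \<gamma>"
    using insert.hyps(1) by (simp add: times_plus_ordinal)
  also have "\<dots> \<le> r + omega_pow \<gamma>"
    using insert.IH[of r] insert.prems(1) r(1) by (intro plus_ordinal_mono_left) simp
  also have "\<dots> \<le> r + \<xi>'"
    by (rule plus_ordinal_mono) fact
  also have "\<dots> \<le> \<xi>"
    using insert.prems(2) by (simp add: \<xi>')
  finally show ?case .
qed simp

text \<open>For \<open>\<delta> < \<gamma>\<close>, infinitely many positive points of rank
  \<open>\<delta>\<close> lie up to \<open>\<xi>\<close>; any \<open>m\<close> of them force
  \<open>omega_pow \<delta> * ord_of_nat m \<le> \<xi>\<close>.\<close>

lemma omega_pow_le_of_mem_derived:
  fixes \<gamma> \<xi> :: "'a::infinite ordinal"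
  assumes "\<xi> \<in> derived UNIV \<gamma>" "0 < \<xi>"
  shows "omega_pow \<gamma> \<le> \<xi>"
  using assms
proof (induction \<gamma> arbitrary: \<xi> rule: less_induct)
  case (less \<gamma>)
  show ?case
  proof (rule omega_pow_least)
    show "1 \<le> \<xi>"
      using less.prems(2) by (rule one_le_ordinal)
    fix \<delta> assume \<delta>: "\<delta> < \<gamma>"
    show "omega_pow \<delta> * \<omega> \<le> \<xi>"
    proof (rule times_omega_leI)
      fix m
      have "\<xi> islimpt derived UNIV \<delta> \<inter> {0<..\<xi>}"
        using less.prems \<delta> islimpt_Int_open[OF open_greaterThanAtMost_ordinal, of \<xi> 0 \<xi>]
        by (simp add: mem_derived_iff)
      then have "infinite (derived UNIV \<delta> \<inter> {0<..\<xi>})"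
        using islimpt_finite by blast
      then obtain F where "finite F" "card F = m" "F \<subseteq> derived UNIV \<delta> \<inter> {0<..\<xi>}"
        using infinite_arbitrarily_large by metis
      then show "omega_pow \<delta> * ord_of_nat m \<le> \<xi>"
        using omega_pow_times_card_le[OF less.IH[OF \<delta>], of F \<xi>] by simp
    qed
  qed
qed

text \<open>The points \<open>a + omega_pow d * ord_of_nat (Suc j)\<close> with
  \<open>\<epsilon> \<le> d < \<rho>\<close> are cofinal below and have rank \<open>d\<close>. The
  summand \<open>a\<close> is kept general because such a point is
  \<open>a + omega_pow d * ord_of_nat j\<close> plus \<open>omega_pow d\<close>.\<close>

lemma plus_omega_pow_mem_derived: "a + omega_pow \<rho> \<in> derived UNIV (\<rho> :: 'a::infinite ordinal)"
proof (induction \<rho> arbitrary: a rule: less_induct)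
  case (less \<rho>)
  have "\<exists>q\<in>derived UNIV \<epsilon>. b < q \<and> q < a + omega_pow \<rho>"
    if \<epsilon>: "\<epsilon> < \<rho>" and b: "b < a + omega_pow \<rho>" for \<epsilon> b
  proof -
    have "\<exists>d j. \<epsilon> \<le> d \<and> d < \<rho> \<and> b < a + omega_pow d * ord_of_nat (Suc j)"
      using b
    proof (cases rule: less_plus_ordinalE)
      case 1
      then have "b < a + omega_pow \<epsilon> * ord_of_nat (Suc 0)"
        using le_plus_ordinal less_le_trans by metis
      then show ?thesis
        using \<epsilon> by blast
    next
      case (2 b')
      from 2(1) show ?thesis
      proof (cases rule: less_omega_powE)
        case 1
        then have "b < a + omega_pow \<epsilon> * ord_of_nat (Suc 0)"
          using plus_ordinal_strict_mono[OF omega_pow_pos, of a \<epsilon>] by (simp add: 2)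
        then show ?thesis
          using \<epsilon> by blast
      next
        case d: (2 d j)
        have "omega_pow d * ord_of_nat j \<le> omega_pow (max d \<epsilon>) * ord_of_nat j"
          by (intro times_ordinal_mono_left omega_pow_mono) simp
        also have "\<dots> \<le> omega_pow (max d \<epsilon>) * ord_of_nat (Suc j)"
          by (simp add: times_ordinal_mono le_plus_ordinal)
        finally have "b < a + omega_pow (max d \<epsilon>) * ord_of_nat (Suc j)"
          using d(2) less_le_trans unfolding 2(2) plus_ordinal_less_iff by metis
        then show ?thesis
          using d(1) \<epsilon> by (intro exI[of _ "max d \<epsilon>"] exI[of _ j]) simp
      qed
    qed
    then obtain d j where d: "\<epsilon> \<le> d" "d < \<rho>" "b < a + omega_pow d * ord_of_nat (Suc j)"
      by blast
    have "a + omega_pow d * ord_of_nat (Suc j) = (a + omega_pow d * ord_of_nat j) + omega_pow d"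
      by (simp add: times_plus_ordinal plus_ordinal_assoc)
    then have "a + omega_pow d * ord_of_nat (Suc j) \<in> derived UNIV d"
      using less.IH[OF d(2)] by metis
    moreover have "omega_pow d * ord_of_nat (Suc j) < omega_pow \<rho>"
      using times_ordinal_ord_of_nat_less omega_pow_bound[OF d(2)] by (rule less_le_trans)
    ultimately show ?thesis
      using d(3) derived_antimono[OF d(1), of UNIV] plus_ordinal_strict_mono by blast
  qed
  moreover have "0 < a + omega_pow \<rho>"
    using le_plus_ordinal_right omega_pow_pos less_le_trans by metis
  ultimately show ?case
    by (intro mem_derived_ordinalI) simp_all
qed

lemma derived_lessThan_ordinal: "derived {..<\<theta> :: 'a ordinal} \<gamma> = derived UNIV \<gamma> \<inter> {..<\<theta>}"
  using derived_Int_open[OF open_lessThan, of UNIV \<theta>] by simp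

lemma not_thin_lessThan_omega_pow: "\<not> thin \<beta> {..<omega_pow \<beta> :: 'a::infinite ordinal}"
proof -
  have "omega_pow \<epsilon> \<in> derived {..<omega_pow \<beta>} \<epsilon>" if "\<epsilon> < \<beta>" for \<epsilon>
    using plus_omega_pow_mem_derived[of 0 \<epsilon>] omega_pow_strict_mono[OF that]
    by (simp add: derived_lessThan_ordinal)
  then show ?thesis
    unfolding thin_def by blast
qed

lemma ex_nsets_derived_lessThan:
  fixes \<rho> :: "'a::infinite ordinal"
  shows "\<exists>P. P \<in> [derived {..<omega_pow \<rho> * ord_of_nat M + 1} \<rho>]\<^bsup>M\<^esup>"
proof -
  define h where "h i = omega_pow \<rho> * ord_of_nat (Suc i)" for i
  have "strict_mono h"
    unfolding h_def strict_mono_def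
    by (metis Suc_less_eq omega_pow_pos ord_of_nat_strict_mono times_ordinal_strict_mono)
  then have "card (h ` {..<M}) = M"
    by (simp add: card_image strict_mono_imp_inj_on)
  moreover have "h i \<in> derived {..<omega_pow \<rho> * ord_of_nat M + 1} \<rho>" if "i < M" for i
  proof -
    have "h i = omega_pow \<rho> * ord_of_nat i + omega_pow \<rho>"
      by (simp add: h_def times_plus_ordinal)
    moreover have "h i \<le> omega_pow \<rho> * ord_of_nat M"
      unfolding h_def using that by (intro times_ordinal_mono) (simp del: ord_of_nat.simps)
    ultimately show ?thesis
      unfolding derived_lessThan_ordinal less_plus_one_ordinal_iff
      by (simp add: plus_omega_pow_mem_derived less_plus_one_ordinal_iff)
  qed
  ultimately have "h ` {..<M} \<in> [derived {..<omega_pow \<rho> * ord_of_nat M + 1} \<rho>]\<^bsup>M\<^esup>"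
    by (auto simp: nsets_def)
  then show ?thesis ..
qed

section \<open>Closed copies\<close>

text \<open>A monotone map of ordinals can only be discontinuous from the left.\<close>

lemma continuous_on_ordinalI:
  fixes f :: "'a::infinite ordinal \<Rightarrow> 'a ordinal"
  assumes "strict_mono_on X f"
    and left: "\<And>x b. x \<in> X \<Longrightarrow> b < f x \<Longrightarrow> (\<forall>y\<in>X. y \<le> x \<longrightarrow> b < f y) \<or>
      (\<exists>a<x. \<forall>y\<in>X. a < y \<and> y \<le> x \<longrightarrow> b < f y)"
  shows "continuous_on X f"
  unfolding continuous_on_topological
proof (intro ballI allI impI)
  fix x B assume x: "x \<in> X" and B: "open B" "f x \<in> B"
  have mono: "f y \<le> f x" if "y \<in> X" "y \<le> x" for y
    using assms(1) x that by (meson strict_mono_on_leD)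
  show "\<exists>A. open A \<and> x \<in> A \<and> (\<forall>y\<in>X. y \<in> A \<longrightarrow> f y \<in> B)"
    using B
  proof (cases rule: open_ordinalE)
    case 1
    then have "f y \<in> B" if "y \<in> X" "y \<le> x" for y
      using mono[OF that] B(2) by simp
    then show ?thesis
      by (intro exI[of _ "{..x}"]) (simp add: open_atMost_ordinal)
  next
    case (2 b)
    from left[OF x 2(1)] show ?thesis
    proof (elim disjE exE conjE)
      assume "\<forall>y\<in>X. y \<le> x \<longrightarrow> b < f y"
      then have "f y \<in> B" if "y \<in> X" "y \<le> x" for y
        using 2(2) mono that by auto
      then show ?thesis
        by (intro exI[of _ "{..x}"]) (simp add: open_atMost_ordinal)
    next
      fix a assume a: "a < x" "\<forall>y\<in>X. a < y \<and> y \<le> x \<longrightarrow> b < f y"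
      then have "f y \<in> B" if "y \<in> X" "a < y" "y \<le> x" for y
        using 2(2) mono that by auto
      then show ?thesis
        using a(1) by (intro exI[of _ "{a<..x}"]) (simp add: open_greaterThanAtMost_ordinal)
    qed
  qed
qed

lemma countable_ordLeq_infinite:
  assumes "countable A"
  shows "|A| \<le>o |UNIV :: 'a::infinite set|"
proof -
  obtain f :: "'b \<Rightarrow> nat" where f: "inj_on f A"
    using assms by (auto simp: countable_def)
  obtain g :: "nat \<Rightarrow> 'a" where g: "inj g"
    using infinite_countable_subset[OF infinite_UNIV] by blast
  have "inj_on (g \<circ> f) A"
    using f g by (simp add: comp_inj_on inj_on_subset)
  then show ?thesis
    by (metis card_of_ordLeq subset_UNIV)
qed

text \<open>The collapse onto the order type is continuous for every \<open>Y\<close>. Its inverse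
  can jump only at a limit \<open>x\<close>, where the supremum of the earlier values stays below
  \<open>g x\<close>; the hypothesis, closedness of \<open>Y\<close> in its supremum, forbids
  this.\<close>

lemma ex_order_homeomorphism:
  fixes Y :: "'a::infinite ordinal set"
  assumes "countable Y" and closed: "\<forall>y\<in>Y. \<forall>z<y. z islimpt Y \<longrightarrow> z \<in> Y"
  shows "\<exists>(\<xi> :: 'a ordinal) f g. homeomorphism Y {..<\<xi>} f g \<and> strict_mono_on Y f"
proof -
  define r where "r = {(x, y). x \<in> Y \<and> y \<in> Y \<and> x \<le> y}"
  have field: "Field r = Y"
    by (auto simp: r_def Field_def)
  have "wf (r - Id)"
    by (rule wf_subset[OF wf]) (auto simp: r_def)
  then have "Well_order r"
    unfolding well_order_on_def linear_order_on_def partial_order_on_def preorder_on_def field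
    by (auto simp: r_def refl_on_def total_on_def intro!: transI antisymI)
  then obtain \<xi> :: "'a ordinal" and f where bij: "bij_betw f (Field r) {..<\<xi>}"
    and iff: "\<And>x y. x \<in> Field r \<Longrightarrow> y \<in> Field r \<Longrightarrow> (x, y) \<in> r \<longleftrightarrow> f x \<le> f y"
    using ex_order_type[of r, where 'a = 'a] countable_ordLeq_infinite[OF assms(1)]
    unfolding field by metis
  have f_le: "f x \<le> f y \<longleftrightarrow> x \<le> y" if "x \<in> Y" "y \<in> Y" for x y
    using iff[unfolded field] that by (simp add: r_def)
  have f_less: "f x < f y \<longleftrightarrow> x < y" if "x \<in> Y" "y \<in> Y" for x y
    using f_le[OF that(2,1)] by (simp flip: not_le)
  have bij: "bij_betw f Y {..<\<xi>}"
    using bij by (simp only: field)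
  define g where "g = inv_into Y f"
  have g: "g a \<in> Y" "f (g a) = a" if "a < \<xi>" for a
    using bij that by (auto simp: g_def bij_betw_def f_inv_into_f inv_into_into)
  have gf: "g (f y) = y" and f: "f y < \<xi>" if "y \<in> Y" for y
    using bij that by (auto simp: g_def bij_betw_def)
  have g_less: "g a < g b \<longleftrightarrow> a < b" if "a < \<xi>" "b < \<xi>" for a b
    using f_less[of "g a" "g b"] g that by simp
  have g_le: "g a \<le> g b \<longleftrightarrow> a \<le> b" if "a < \<xi>" "b < \<xi>" for a b
    using g_less[OF that(2,1)] by (simp flip: not_less)
  have mono: "strict_mono_on Y f" "strict_mono_on {..<\<xi>} g"
    using f_less g_less by (simp_all add: strict_mono_on_def)
  have cont_f: "continuous_on Y f"
  proof (rule continuous_on_ordinalI[OF mono(1)], rule disjI2)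
    fix x b assume x: "x \<in> Y" "b < f x"
    then have b: "b < \<xi>"
      using f less_trans by blast
    show "\<exists>a<x. \<forall>y\<in>Y. a < y \<and> y \<le> x \<longrightarrow> b < f y"
    proof (intro exI conjI ballI impI)
      show "g b < x"
        using f_less[OF g(1)[OF b] x(1)] g(2)[OF b] x(2) by simp
      show "b < f y" if "y \<in> Y" "g b < y \<and> y \<le> x" for y
        using f_less[OF g(1)[OF b] that(1)] g(2)[OF b] that(2) by simp
    qed
  qed
  have cont_g: "continuous_on {..<\<xi>} g"
  proof (rule continuous_on_ordinalI[OF mono(2)])
    fix x b assume "x \<in> {..<\<xi>}" and b: "b < g x"
    then have x: "x < \<xi>"
      by simp
    have below: "a < \<xi>" if "a < x" for a
      using that x by (rule less_trans)
    consider (base) "x = 0" | (above) a where "a < x" "b \<le> g a" | (succ) a where "x = a + 1"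
      | (limit) "0 < x" "\<And>a. a < x \<Longrightarrow> a + 1 < x" "\<And>a. a < x \<Longrightarrow> g a < b"
      by (metis le_less linorder_not_le plus_one_ordinal_le_iff zero_le_ordinal)
    then show "(\<forall>y\<in>{..<\<xi>}. y \<le> x \<longrightarrow> b < g y) \<or>
      (\<exists>a<x. \<forall>y\<in>{..<\<xi>}. a < y \<and> y \<le> x \<longrightarrow> b < g y)"
    proof cases
      case base
      then show ?thesis
        using b by simp
    next
      case above
      then have "b < g y" if "a < y" "y \<le> x" for y
        using g_less[of a y] below[of a] x that by (metis le_less_trans)
      then show ?thesis
        using above(1) by blast
    next
      case succ
      then have "y = x" if "a < y \<and> y \<le> x" for y
        using that by (simp add: antisym plus_one_ordinal_le_iff)
      moreover have "a < x"
        by (simp add: succ less_plus_one_ordinal_iff)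
      ultimately show ?thesis
        using b by blast
    next
      case limit
      \<comment> \<open>The supremum of the earlier values. It lies in \<open>Y\<close> and hence is
        a value \<open>g a\<close> with \<open>a < x\<close>, but all those are strictly below
        \<open>z\<close>.\<close>
      define z where "z = (LEAST z. \<forall>a<x. g a \<le> z)"
      have z: "\<forall>a<x. g a \<le> z"
        unfolding z_def by (rule LeastI[of _ b]) (simp add: limit(3) less_imp_le)
      have "z \<le> b"
        unfolding z_def using limit(3) by (intro Least_le) (simp add: less_imp_le)
      have z_less: "g a < z" if "a < x" for a
      proof -
        have "g a < g (a + 1)"
          using g_less[OF below[OF that] below[OF limit(2)[OF that]]]
          by (simp add: less_plus_one_ordinal_iff)
        also have "g (a + 1) \<le> z"
          using z limit(2)[OF that] by blast
        finally show ?thesis .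
      qed
      have "z islimpt Y"
        unfolding islimpt_ordinal_iff
      proof (intro conjI allI impI)
        show "0 < z"
          using z_less[OF limit(1)] by (rule le_less_trans[OF zero_le_ordinal])
        fix c assume "c < z"
        then have "\<not> (\<forall>a<x. g a \<le> c)"
          unfolding z_def by (rule not_less_Least)
        then obtain a where "a < x" "c < g a"
          by (auto simp: not_le)
        then show "\<exists>q\<in>Y. c < q \<and> q < z"
          using z_less g(1) below by (intro bexI[of _ "g a"]) simp_all
      qed
      then have "z \<in> Y"
        using closed g(1)[OF x] le_less_trans[OF \<open>z \<le> b\<close> b] by blast
      moreover have "f z < x"
        using f_less[OF \<open>z \<in> Y\<close> g(1)[OF x]] g(2)[OF x] le_less_trans[OF \<open>z \<le> b\<close> b] by simp
      ultimately have False
        using z_less[of "f z"] gf[of z] by simp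
      then show ?thesis ..
    qed
  qed
  have "homeomorphism Y {..<\<xi>} f g"
    by (rule homeomorphismI[OF cont_f cont_g]) (auto simp: f g gf)
  then show ?thesis
    using mono(1) by blast
qed

lemma order_homeomorphic_initial_segment:
  assumes "homeomorphism Y {..<\<xi>} f g" "strict_mono_on Y f" "\<theta> \<le> \<xi>"
  shows "\<exists>Z\<subseteq>Y. order_homeomorphic Z {..<\<theta>}"
proof (intro exI conjI)
  have sub: "{..<\<theta>} \<subseteq> {..<\<xi>}"
    using assms(3) by auto
  then show Z: "g ` {..<\<theta>} \<subseteq> Y"
    using homeomorphism_image2[OF assms(1)] image_mono[of "{..<\<theta>}" "{..<\<xi>}" g] by simp
  have "f ` g ` {..<\<theta>} = {..<\<theta>}"
    using homeomorphism_apply2[OF assms(1)] sub by (force simp: image_image)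
  then have "homeomorphism (g ` {..<\<theta>}) {..<\<theta>} f g"
    using homeomorphism_of_subsets[OF assms(1) Z sub] by blast
  then show "order_homeomorphic (g ` {..<\<theta>}) {..<\<theta>}"
    using monotone_on_subset[OF assms(2) Z] unfolding order_homeomorphic_def by blast
qed

text \<open>With \<open>t\<close> enumerating all pairs of a point of \<open>X\<close> below
  \<open>p\<close> and a rank below \<open>\<gamma>\<close>, the sequence becomes cofinal in
  \<open>p\<close> and meets every such rank beyond every such point.\<close>

lemma increasing_sequence:
  fixes X :: "'a::infinite ordinal set"
  assumes "p islimpt X" and t: "\<And>n. t n \<in> X \<times> {..<\<gamma>} \<Longrightarrow> p islimpt derived X (snd (t n))"
  shows "\<exists>q :: nat \<Rightarrow> 'a ordinal. \<forall>n. q n < p \<and> q n < q (Suc n) \<and>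
    (t n \<in> (X \<inter> {..<p}) \<times> {..<\<gamma>} \<longrightarrow> fst (t n) < q (Suc n) \<and> q (Suc n) \<in> derived X (snd (t n)))"
proof -
  define Q where "Q n x y \<longleftrightarrow> x < y \<and>
    (t n \<in> (X \<inter> {..<p}) \<times> {..<\<gamma>} \<longrightarrow> fst (t n) < y \<and> y \<in> derived X (snd (t n)))" for n x y
  have "\<exists>q. \<forall>n. q n < p \<and> Q n (q n) (q (Suc n))"
  proof (rule dependent_nat_choice)
    show "\<exists>x. x < p"
      using assms(1) islimpt_ordinal_iff by blast
    fix x n assume x: "x < p"
    show "\<exists>y<p. Q n x y"
    proof (cases "t n \<in> (X \<inter> {..<p}) \<times> {..<\<gamma>}")
      case True
      then have "p islimpt derived X (snd (t n))" "max x (fst (t n)) < p"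
        using t[of n] x by auto
      then obtain y where "y \<in> derived X (snd (t n))" "max x (fst (t n)) < y" "y < p"
        unfolding islimpt_ordinal_iff by metis
      then show ?thesis
        by (auto simp: Q_def)
    next
      case False
      then show ?thesis
        using assms(1) x unfolding Q_def islimpt_ordinal_iff by metis
    qed
  qed
  then show ?thesis
    unfolding Q_def .
qed

text \<open>The sequence \<open>q\<close> cuts the part below \<open>p\<close> into open intervals
  \<open>I n\<close>, and the induction hypothesis gives a closed \<open>Z n\<close> inside
  \<open>I n\<close> in which \<open>q (Suc n)\<close> has the rank demanded by the task. Their
  union with \<open>p\<close> added is closed, because an initial segment bounded below
  \<open>p\<close> meets only finitely many \<open>Z n\<close>.\<close>

lemma ex_closed_subset_derived:
  fixes X :: "'a::infinite ordinal set"
  assumes "countable X" "countable {..<\<gamma>}" "p \<in> derived X \<gamma>"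
  shows "\<exists>Y\<subseteq>X. closed Y \<and> p \<in> derived Y \<gamma>"
  using assms
proof (induction \<gamma> arbitrary: X p rule: less_induct)
  case (less \<gamma>)
  have "p \<in> X"
    using less.prems(3) derived_subset by blast
  show ?case
  proof (cases "\<gamma> = 0")
    case True
    then show ?thesis
      using \<open>p \<in> X\<close> by (intro exI[of _ "{p}"]) simp
  next
    case False
    have lim: "p islimpt derived X \<delta>" if "\<delta> < \<gamma>" for \<delta>
      using less.prems(3) that by (simp add: mem_derived_iff)
    have pos: "0 < \<gamma>"
      using False by (simp add: less_le)
    have limX: "p islimpt X"
      using lim[OF pos] by simp
    define T where "T = (X \<inter> {..<p}) \<times> {..<\<gamma>}"
    have "countable T"
      unfolding T_def using less.prems(1,2) by (intro countable_SIGMA countable_Int1) auto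
    from frequent_enumeration[OF this] obtain t :: "nat \<Rightarrow> _" where "\<forall>u\<in>T. \<forall>N. \<exists>n\<ge>N. t n = u" ..
    then have t: "\<exists>n. t n = u" if "u \<in> T" for u
      using that by metis
    have lim_t: "p islimpt derived X (snd (t n))" if "t n \<in> X \<times> {..<\<gamma>}" for n
      using lim that by (cases "t n") simp
    from increasing_sequence[of p X t \<gamma>, OF limX lim_t, folded T_def]
    obtain q where "\<forall>n. q n < p \<and> q n < q (Suc n) \<and>
      (t n \<in> T \<longrightarrow> fst (t n) < q (Suc n) \<and> q (Suc n) \<in> derived X (snd (t n)))" ..
    then have q: "\<And>n. q n < p" "\<And>n. q n < q (Suc n)"
      "\<And>n. t n \<in> T \<Longrightarrow> fst (t n) < q (Suc n) \<and> q (Suc n) \<in> derived X (snd (t n))"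
      by simp_all
    have q_mono: "q m \<le> q n" if "m \<le> n" for m n
      using that by (rule lift_Suc_mono_le[rotated]) (simp add: q(2) less_imp_le)
    define I where "I n = {q n<..q (Suc n)}" for n
    have "\<exists>Z. Z \<subseteq> X \<inter> I n \<and> closed Z \<and> (t n \<in> T \<longrightarrow> q (Suc n) \<in> derived Z (snd (t n)))" for n
    proof (cases "t n \<in> T")
      case True
      then have \<delta>: "snd (t n) < \<gamma>"
        by (auto simp: T_def)
      have "open (I n)"
        unfolding I_def by (rule open_greaterThanAtMost_ordinal)
      then have "q (Suc n) \<in> derived (X \<inter> I n) (snd (t n))"
        using q(2)[of n] q(3)[OF True] by (simp add: derived_Int_open I_def)
      moreover have "countable {..<snd (t n)}"
        by (rule countable_subset[OF _ less.prems(2)]) (use \<delta> in auto)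
      ultimately show ?thesis
        using less.IH[OF \<delta> countable_Int1[OF less.prems(1)]] by blast
    qed (intro exI[of _ "{}"], simp)
    then obtain Z where Z: "\<And>n. Z n \<subseteq> X \<inter> I n" "\<And>n. closed (Z n)"
      "\<And>n. t n \<in> T \<Longrightarrow> q (Suc n) \<in> derived (Z n) (snd (t n))"
      by metis
    define Y where "Y = insert p (\<Union>n. Z n)"
    have "I n \<subseteq> {..<p}" for n
      using q(1) by (auto simp: I_def intro: le_less_trans)
    then have Y_le: "Y \<subseteq> {..p}"
      using Z(1) by (fastforce simp: Y_def intro: less_imp_le)
    have "z \<in> Y" if z: "z islimpt Y" for z
    proof -
      have "z \<le> p"
        using z Y_le unfolding islimpt_ordinal_iff by (meson atMost_iff linorder_not_le subsetD)
      show ?thesis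
      proof (cases "z = p")
        case False
        with \<open>z \<le> p\<close> have "z < p"
          by simp
        then obtain x where x: "x \<in> X" "z < x" "x < p"
          using limX unfolding islimpt_ordinal_iff by metis
        \<comment> \<open>Rank 0 is demanded only to push \<open>q\<close> beyond
          \<open>z\<close>.\<close>
        then have "(x, 0) \<in> T"
          using pos by (simp add: T_def)
        then obtain n where "z < q (Suc n)"
          using t q(3) x(2) by (metis fst_conv less_trans)
        then have "z islimpt Y \<inter> {..<q (Suc n)}"
          using islimpt_Int_open[OF open_lessThan] z by blast
        moreover have "Y \<inter> {..<q (Suc n)} \<subseteq> (\<Union>i\<le>n. Z i)"
        proof
          fix y assume y: "y \<in> Y \<inter> {..<q (Suc n)}"
          then have "y \<noteq> p"
            using q(1)[of "Suc n"] by auto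
          then obtain i where i: "y \<in> Z i"
            using y by (auto simp: Y_def)
          then have "q i < y"
            using Z(1)[of i] by (auto simp: I_def)
          then have "\<not> Suc n \<le> i"
            using q_mono[of "Suc n" i] y by (metis IntD2 leD lessThan_iff less_le_trans order.asym)
          then show "y \<in> (\<Union>i\<le>n. Z i)"
            using i by auto
        qed
        ultimately have "z islimpt (\<Union>i\<le>n. Z i)"
          by (rule islimpt_subset)
        moreover have "closed (\<Union>i\<le>n. Z i)"
          using Z(2) by (intro closed_UN) auto
        ultimately show ?thesis
          by (auto simp: closed_limpt Y_def)
      qed (simp add: Y_def)
    qed
    then have "closed Y"
      by (simp add: closed_limpt)
    moreover have "p \<in> derived Y \<gamma>"
    proof (rule mem_derived_ordinalI)
      show "p \<in> Y"
        by (simp add: Y_def)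
      show "0 < p"
        using limX by (simp add: islimpt_ordinal_iff)
      fix \<delta> b assume \<delta>: "\<delta> < \<gamma>" and "b < p"
      then obtain x where x: "x \<in> X" "b < x" "x < p"
        using limX unfolding islimpt_ordinal_iff by metis
      then have "(x, \<delta>) \<in> T"
        using \<delta> by (simp add: T_def)
      then obtain n where n: "t n = (x, \<delta>)" "t n \<in> T"
        using t by metis
      then have "b < q (Suc n)" "q (Suc n) \<in> derived (Z n) \<delta>"
        using q(3) Z(3) x(2) by (metis fst_conv less_trans, metis snd_conv)
      moreover have "derived (Z n) \<delta> \<subseteq> derived Y \<delta>"
        by (rule derived_mono) (auto simp: Y_def)
      ultimately show "\<exists>q\<in>derived Y \<delta>. b < q \<and> q < p"
        using q(1) by blast
    qed
    moreover have "Y \<subseteq> X"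
      using Z(1) \<open>p \<in> X\<close> by (auto simp: Y_def)
    ultimately show ?thesis
      by blast
  qed
qed

lemma image_derived_initial_segment:
  assumes "homeomorphism Y {..<\<xi> :: 'a ordinal} f g" "y \<in> derived Y \<gamma>"
  shows "f y \<in> derived UNIV \<gamma>" "f y < \<xi>"
proof -
  have "f ` derived Y \<gamma> \<subseteq> derived {..<\<xi>} \<gamma>"
    using derived_image_subset[OF homeomorphism_cont1[OF assms(1)], of \<gamma>]
      homeomorphism_image1[OF assms(1)] homeomorphism_apply1[OF assms(1)]
    by (metis inj_on_inverseI)
  then show "f y \<in> derived UNIV \<gamma>" "f y < \<xi>"
    using assms(2) by (auto simp: derived_lessThan_ordinal)
qed

text \<open>A finite union of closed sets, one for each point of \<open>F\<close>, is closed and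
  collapses to an ordinal \<open>\<xi>\<close> with \<open>m\<close> positive points of rank
  \<open>\<gamma>\<close>. The largest is at least \<open>omega_pow \<gamma> * ord_of_nat m\<close>,
  and it lies below \<open>\<xi>\<close>, which accounts for the final 1.\<close>

lemma ex_closed_copy_successor:
  fixes X :: "'a::infinite ordinal set"
  assumes "countable X" "countable {..<\<gamma>}" "0 < \<gamma>" "0 < m" "F \<in> [derived X \<gamma>]\<^bsup>m\<^esup>"
  shows "\<exists>Y\<subseteq>X. order_homeomorphic Y {..<omega_pow \<gamma> * ord_of_nat m + 1}"
proof -
  have F: "finite F" "card F = m" "F \<subseteq> derived X \<gamma>"
    using assms(5) by (simp_all add: nsets_def)
  then have "\<exists>Z\<subseteq>X. closed Z \<and> p \<in> derived Z \<gamma>" if "p \<in> F" for p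
    using ex_closed_subset_derived assms(1,2) that by blast
  then obtain Z where Z: "\<And>p. p \<in> F \<Longrightarrow> Z p \<subseteq> X" "\<And>p. p \<in> F \<Longrightarrow> closed (Z p)"
    "\<And>p. p \<in> F \<Longrightarrow> p \<in> derived (Z p) \<gamma>"
    by metis
  define Y where "Y = (\<Union>p\<in>F. Z p)"
  have "Y \<subseteq> X"
    using Z(1) by (auto simp: Y_def)
  have "closed Y"
    unfolding Y_def using F(1) Z(2) by (intro closed_UN) auto
  have "F \<subseteq> derived Y \<gamma>"
    using Z(3) derived_mono[of "Z _" Y \<gamma>] by (force simp: Y_def)
  have "\<forall>y\<in>Y. \<forall>z<y. z islimpt Y \<longrightarrow> z \<in> Y"
    using \<open>closed Y\<close> by (simp add: closed_limpt)
  from ex_order_homeomorphism[OF countable_subset[OF \<open>Y \<subseteq> X\<close> assms(1)] this]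
  obtain \<xi> :: "'a ordinal" and f g where f: "homeomorphism Y {..<\<xi>} f g" "strict_mono_on Y f"
    by blast
  have "F \<subseteq> Y"
    using \<open>F \<subseteq> derived Y \<gamma>\<close> derived_subset by blast
  then have "card (f ` F) = m"
    using F(2) strict_mono_on_imp_inj_on[OF f(2)] by (metis card_image inj_on_subset)
  have "f y \<in> derived UNIV \<gamma> \<and> f y < \<xi>" if "y \<in> F" for y
    using image_derived_initial_segment[OF f(1), of y \<gamma>] \<open>F \<subseteq> derived Y \<gamma>\<close> that by blast
  then have fF: "f ` F \<subseteq> derived UNIV \<gamma>" "f ` F \<subseteq> {..<\<xi>}"
    by auto
  define x where "x = Max (f ` F)"
  have "F \<noteq> {}"
    using F(2) assms(4) by auto
  then have x: "x \<in> f ` F" "f ` F \<subseteq> {..x}"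
    using F(1) by (auto simp: x_def)
  have "f ` F \<subseteq> {0<..x}"
    using x(2) derived_pos[OF subsetD[OF fF(1)] assms(3)] by fastforce
  then have "omega_pow \<gamma> * ord_of_nat m \<le> x"
    using omega_pow_times_card_le[OF omega_pow_le_of_mem_derived finite_imageI[OF F(1)] fF(1)]
      \<open>card (f ` F) = m\<close> by simp
  also have "x < \<xi>"
    using x(1) fF(2) by auto
  finally have "omega_pow \<gamma> * ord_of_nat m + 1 \<le> \<xi>"
    by (simp add: plus_one_ordinal_le_iff)
  then show ?thesis
    using order_homeomorphic_initial_segment[OF f] \<open>Y \<subseteq> X\<close> by (meson subset_trans)
qed

lemma limit_ordinal_pos: "limit_ordinal \<gamma> \<Longrightarrow> 0 < \<gamma>"
  by (simp add: limit_ordinal_def less_le)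

text \<open>
  Adding the least point below which the ranks are unbounded reduces the limit case to
  the construction for a single point.
\<close>

lemma ex_closed_copy_limit:
  fixes X :: "'a::infinite ordinal set"
  assumes "countable X" "countable {..<\<gamma>}" "limit_ordinal \<gamma>" "\<not> thin \<gamma> X"
  shows "\<exists>Y\<subseteq>X. order_homeomorphic Y {..<omega_pow \<gamma>}"
proof -
  have succ: "\<delta> + 1 < \<gamma>" if "\<delta> < \<gamma>" for \<delta>
    using assms(3) that by (simp add: limit_ordinal_def)
  note pos = limit_ordinal_pos[OF assms(3)]
  obtain \<Omega> where "\<And>x. x \<in> X \<Longrightarrow> x < \<Omega>"
    using bounded_ordinal[OF countable_ordLeq_infinite[OF assms(1)]] by blast
  then have "X \<inter> {..<\<Omega>} = X"
    by auto
  define s where "s = (LEAST s. \<not> thin \<gamma> (X \<inter> {..<s}))"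
  have s: "\<not> thin \<gamma> (X \<inter> {..<s})"
    unfolding s_def by (rule LeastI[of _ \<Omega>]) (simp add: \<open>X \<inter> {..<\<Omega>} = X\<close> assms(4))
  have below: "thin \<gamma> (X \<inter> {..<b})" if "b < s" for b
    using that not_less_Least unfolding s_def by blast
  have "X \<inter> {..<0} = {}"
    by auto
  then have "thin \<gamma> (X \<inter> {..<0})"
    unfolding thin_def using pos by (intro exI[of _ 0]) simp
  then have "0 < s"
    using s by (metis less_le zero_le_ordinal)
  have "s \<in> derived (insert s X) \<gamma>"
  proof (rule mem_derived_ordinalI)
    fix \<delta> b assume \<delta>: "\<delta> < \<gamma>" and b: "b < s"
    obtain \<delta>0 where \<delta>0: "\<delta>0 < \<gamma>" "derived (X \<inter> {..<b}) \<delta>0 = {}"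
      using below[OF b] unfolding thin_def by blast
    define d where "d = max \<delta> \<delta>0"
    have "d + 1 < \<gamma>"
      using \<delta> \<delta>0(1) by (simp add: d_def succ)
    then obtain q where q: "q \<in> derived X (d + 1)" "q < s"
      using s unfolding thin_def by (auto simp: derived_Int_open)
    \<comment> \<open>No point of rank \<open>d\<close> lies below \<open>b\<close>. Rank
      \<open>d + 1\<close> provides another point of rank \<open>d\<close> below \<open>q\<close>,
      which makes \<open>b < q\<close> strict.\<close>
    have lim: "q islimpt derived X d"
      using q(1) by (simp add: mem_derived_iff less_plus_one_ordinal_iff)
    have no: "b \<le> q'" if "q' \<in> derived X d" for q'
    proof (rule ccontr)
      assume "\<not> b \<le> q'"
      then have "q' \<in> derived X d \<inter> {..<b}"
        using that by simp
      also have "\<dots> \<subseteq> derived X \<delta>0 \<inter> {..<b}"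
        using derived_antimono[of \<delta>0 d X] by (auto simp: d_def)
      finally have "q' \<in> derived (X \<inter> {..<b}) \<delta>0"
        by (simp add: derived_Int_open)
      then show False
        using \<delta>0(2) by simp
    qed
    obtain q' where "q' \<in> derived X d" "q' < q"
      using lim unfolding islimpt_ordinal_iff by blast
    then have "b < q"
      using no le_less_trans by blast
    moreover have "q \<in> derived (insert s X) \<delta>"
    proof -
      have "\<delta> \<le> d + 1"
        by (simp add: d_def le_max_iff_disj less_plus_one_ordinal_iff less_imp_le)
      then show ?thesis
        using q(1) derived_antimono derived_mono[OF subset_insertI] by blast
    qed
    ultimately show "\<exists>q\<in>derived (insert s X) \<delta>. b < q \<and> q < s"
      using q(2) by blast
  qed (simp_all add: \<open>0 < s\<close>)
  then obtain Y where Y: "Y \<subseteq> insert s X" "closed Y" "s \<in> derived Y \<gamma>"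
    using ex_closed_subset_derived[of "insert s X" \<gamma> s] assms(1,2) by auto
  define Z where "Z = Y \<inter> {..<s}"
  have "Z \<subseteq> X"
    using Y(1) by (auto simp: Z_def)
  \<comment> \<open>\<open>Z\<close> omits \<open>s\<close>, so only limits below some member of
    \<open>Z\<close> are claimed; this is all that the collapse requires.\<close>
  have "z \<in> Z" if "y \<in> Z" "z < y" "z islimpt Z" for y z
  proof -
    have "z \<in> Y"
      using islimpt_subset[OF that(3), of Y] Y(2) by (auto simp: Z_def closed_limpt)
    then show ?thesis
      using that(1,2) by (auto simp: Z_def intro: less_trans)
  qed
  then have "\<forall>y\<in>Z. \<forall>z<y. z islimpt Z \<longrightarrow> z \<in> Z"
    by blast
  from ex_order_homeomorphism[OF countable_subset[OF \<open>Z \<subseteq> X\<close> assms(1)] this]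
  obtain \<xi> :: "'a ordinal" and f g where f: "homeomorphism Z {..<\<xi>} f g" "strict_mono_on Z f"
    by blast
  have "omega_pow \<delta> \<le> \<xi>" if \<delta>: "\<delta> < \<gamma>" for \<delta>
  proof -
    \<comment> \<open>Rank \<open>\<delta> + 1\<close> instead of \<open>\<delta>\<close> ensures
      that the image point is not 0.\<close>
    have "s islimpt derived Y (\<delta> + 1)"
      using Y(3) succ[OF \<delta>] by (simp add: mem_derived_iff)
    then obtain y where "y \<in> derived Y (\<delta> + 1)" "y < s"
      unfolding islimpt_ordinal_iff by blast
    then have y: "y \<in> derived Z (\<delta> + 1)"
      by (simp add: Z_def derived_Int_open)
    have "0 < \<delta> + 1"
      by (simp add: less_plus_one_ordinal_iff)
    then have "omega_pow (\<delta> + 1) \<le> f y"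
      using image_derived_initial_segment(1)[OF f(1) y] derived_pos omega_pow_le_of_mem_derived by blast
    moreover have "omega_pow \<delta> \<le> omega_pow (\<delta> + 1)"
      by (intro omega_pow_mono le_plus_ordinal)
    ultimately show ?thesis
      using image_derived_initial_segment(2)[OF f(1) y] by simp
  qed
  then have "omega_pow \<gamma> \<le> \<xi>"
    by (simp add: omega_pow_limit[OF assms(3)])
  then show ?thesis
    using order_homeomorphic_initial_segment[OF f] \<open>Z \<subseteq> X\<close> by (meson subset_trans)
qed

section \<open>Ramsey numbers\<close>

text \<open>Red sets may be shrunk, so the two arrow relations agree for every
  \<open>\<beta>\<close>, and with them their least witnesses.\<close>

lemma R_top_eq_R_cl:
  fixes \<theta> :: "'a ordinal"
  assumes "\<And>X :: 'a ordinal set. X homeomorphic {..<\<theta>} \<Longrightarrow> \<exists>Y\<subseteq>X. order_homeomorphic Y {..<\<theta>}"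
  shows "R_top \<theta> k = R_cl \<theta> k"
proof -
  have "arrows_cl \<beta> \<theta> k" if top: "arrows_top \<beta> \<theta> k" for \<beta>
    unfolding arrows_def ball_nsets_2_iff
  proof
    fix c
    consider X where "X \<subseteq> {..<\<beta>}" "X homeomorphic {..<\<theta>}" "homogeneous c Red X"
      | "\<exists>Y\<in>[{..<\<beta>}]\<^bsup>k\<^esup>. homogeneous c Blue Y"
      using top unfolding arrows_def ball_nsets_2_iff by blast
    then show "(\<exists>X\<subseteq>{..<\<beta>}. order_homeomorphic X {..<\<theta>} \<and> homogeneous c Red X) \<or>
      (\<exists>Y\<in>[{..<\<beta>}]\<^bsup>k\<^esup>. homogeneous c Blue Y)"
    proof cases
      case 1
      then obtain Y where "Y \<subseteq> X" "order_homeomorphic Y {..<\<theta>}"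
        using assms by blast
      then show ?thesis
        using 1 homogeneous_subset by (meson subset_trans)
    qed simp
  qed
  then have "arrows_top \<beta> \<theta> k \<longleftrightarrow> arrows_cl \<beta> \<theta> k" for \<beta>
    using arrows_cl_imp_arrows_top by blast
  then show ?thesis
    unfolding R_top_def R_cl_def by simp
qed

lemma homeomorphic_derived:
  fixes X :: "'b::topological_space set" and S :: "'c::topological_space set"
  assumes "X homeomorphic S"
  obtains g where "inj_on g S" "g ` S = X" "\<And>\<gamma> :: 'a ordinal. g ` derived S \<gamma> \<subseteq> derived X \<gamma>"
proof -
  obtain f g where h: "homeomorphism X S f g"
    using assms by (auto simp: homeomorphic_def)
  have "inj_on g S"
    using homeomorphism_apply2[OF h] by (metis inj_on_inverseI)
  moreover have "g ` S = X"
    by (rule homeomorphism_image2[OF h])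
  moreover have "g ` derived S \<gamma> \<subseteq> derived X \<gamma>" for \<gamma> :: "'a ordinal"
    using derived_image_subset[OF homeomorphism_cont2[OF h] \<open>inj_on g S\<close>] \<open>g ` S = X\<close> by metis
  ultimately show thesis
    by (rule that)
qed

lemma R_top_eq_R_cl_limit:
  fixes \<gamma> :: "'a::infinite ordinal"
  assumes "countable {..<\<gamma>}" "limit_ordinal \<gamma>"
  shows "R_top (omega_pow \<gamma>) k = R_cl (omega_pow \<gamma>) k"
proof (rule R_top_eq_R_cl)
  fix X :: "'a ordinal set" assume "X homeomorphic {..<omega_pow \<gamma>}"
  then obtain g where g: "g ` {..<omega_pow \<gamma>} = X"
    "\<And>\<delta> :: 'a ordinal. g ` derived {..<omega_pow \<gamma>} \<delta> \<subseteq> derived X \<delta>"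
    using homeomorphic_derived by metis
  have "countable X"
    using countable_image[OF countable_lessThan_omega_pow[OF assms(1)], of g] g(1) by simp
  moreover have "\<not> thin \<gamma> X"
    using not_thin_lessThan_omega_pow[of \<gamma>] g(2) unfolding thin_def by fast
  ultimately show "\<exists>Y\<subseteq>X. order_homeomorphic Y {..<omega_pow \<gamma>}"
    by (rule ex_closed_copy_limit[OF _ assms])
qed

lemma countable_lessThan_successor:
  fixes \<gamma> :: "'a::infinite ordinal"
  assumes "countable {..<\<gamma>}"
  shows "countable {..<omega_pow \<gamma> * ord_of_nat m + 1}"
proof -
  have "countable {..<1 :: 'a ordinal}"
    using countable_lessThan_ord_of_nat[of 1, where 'a = 'a] by simp
  then show ?thesis
    using assms by (intro countable_lessThan_plus_ordinal countable_lessThan_times_ordinal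
        countable_lessThan_omega_pow countable_lessThan_ord_of_nat)
qed

lemma R_top_eq_R_cl_successor:
  fixes \<gamma> :: "'a::infinite ordinal"
  assumes "countable {..<\<gamma>}" "0 < \<gamma>" "0 < m"
  shows "R_top (omega_pow \<gamma> * ord_of_nat m + 1) k = R_cl (omega_pow \<gamma> * ord_of_nat m + 1) k"
proof (rule R_top_eq_R_cl)
  define S where "S = {..<omega_pow \<gamma> * ord_of_nat m + 1}"
  fix X :: "'a ordinal set" assume "X homeomorphic {..<omega_pow \<gamma> * ord_of_nat m + 1}"
  then obtain g where g: "inj_on g S" "g ` S = X"
    "\<And>\<delta> :: 'a ordinal. g ` derived S \<delta> \<subseteq> derived X \<delta>"
    using homeomorphic_derived unfolding S_def by metis
  obtain P where P: "P \<in> [derived S \<gamma>]\<^bsup>m\<^esup>"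
    using ex_nsets_derived_lessThan unfolding S_def by blast
  then have "P \<subseteq> derived S \<gamma>"
    by (simp add: nsets_def)
  then have "inj_on g P" "g ` P \<subseteq> derived X \<gamma>"
    using inj_on_subset[OF g(1)] g(3)[of \<gamma>] derived_subset[of S \<gamma>] by blast+
  then have "g ` P \<in> [derived X \<gamma>]\<^bsup>m\<^esup>"
    using P by (auto simp: nsets_def card_image)
  moreover have "countable X"
    using countable_image[OF countable_lessThan_successor[OF assms(1)], of g m] g(2) by (simp add: S_def)
  ultimately show "\<exists>Y\<subseteq>X. order_homeomorphic Y {..<omega_pow \<gamma> * ord_of_nat m + 1}"
    using ex_closed_copy_successor assms by blast
qed

section \<open>Closed partition relations\<close>

lemma arrows_cl_limit:
  fixes \<alpha> :: "'a::infinite ordinal"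
  assumes "countable {..<\<alpha>}" "0 < \<alpha>"
  shows "arrows_cl (omega_pow (omega_pow (\<alpha> * ord_of_nat (Suc k)))) (omega_pow (omega_pow \<alpha>)) (k + 2)"
  unfolding arrows_def ball_nsets_2_iff
proof
  fix c :: "'a ordinal set \<Rightarrow> colour"
  define S where "S = {..<omega_pow (omega_pow (\<alpha> * ord_of_nat (Suc k)))}"
  have S: "countable S"
    unfolding S_def using assms(1)
    by (intro countable_lessThan_omega_pow countable_lessThan_times_ordinal countable_lessThan_ord_of_nat)
  then have "countably_based S"
    unfolding S_def by (rule countably_based_lessThan_ordinal)
  moreover have "\<not> thin (omega_pow (\<alpha> * ord_of_nat (Suc k))) S"
    unfolding S_def by (rule not_thin_lessThan_omega_pow)
  ultimately consider X where "X \<subseteq> S" "homogeneous c Red X" "\<not> thin (omega_pow \<alpha>) X"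
    | "\<exists>Y\<in>[S]\<^bsup>(k + 2)\<^esup>. homogeneous c Blue Y"
    using partition_not_thin[OF assms] by blast
  then show "(\<exists>X\<subseteq>S. order_homeomorphic X {..<omega_pow (omega_pow \<alpha>)} \<and> homogeneous c Red X) \<or>
    (\<exists>Y\<in>[S]\<^bsup>(k + 2)\<^esup>. homogeneous c Blue Y)"
  proof cases
    case 1
    then have "countable X"
      using S countable_subset by metis
    then obtain Y where "Y \<subseteq> X" "order_homeomorphic Y {..<omega_pow (omega_pow \<alpha>)}"
      using ex_closed_copy_limit countable_lessThan_omega_pow limit_ordinal_omega_pow 1(3) assms by metis
    then show ?thesis
      using 1 homogeneous_subset by (meson subset_trans)
  qed simp
qed

text \<open>\<open>e k\<close> is the rank required for blue sets of size \<open>k + 2\<close>, and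
  \<open>\<zeta> k\<close> fixes the notion of thinness in the step to \<open>k + 3\<close>. Keeping
  both general covers infinite powers and finite \<open>\<nu>\<close> at once.\<close>

lemma arrows_cl_successor:
  fixes \<nu> :: "'a::infinite ordinal"
  assumes \<nu>: "countable {..<\<nu>}" "0 < \<nu>" and "countable {..<e k}" "0 < m" "finite_arrows M m (k + 2)"
    and e: "e 0 = \<nu>" "\<And>k. e (Suc k) = omega_pow (\<zeta> k) * \<nu>"
    and \<zeta>: "\<And>k. 0 < \<zeta> k" "\<And>k. e k < omega_pow (\<zeta> k)"
  shows "arrows_cl (omega_pow (e k) * ord_of_nat M + 1) (omega_pow \<nu> * ord_of_nat m + 1) (k + 2)"
  unfolding arrows_def ball_nsets_2_iff
proof
  fix c :: "'a ordinal set \<Rightarrow> colour"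
  define S where "S = {..<omega_pow (e k) * ord_of_nat M + 1}"
  have S: "countable S"
    unfolding S_def by (rule countable_lessThan_successor) fact
  then have based: "countably_based S"
    unfolding S_def by (rule countably_based_lessThan_ordinal)
  obtain P where P: "P \<in> [derived S (e k)]\<^bsup>M\<^esup>"
    using ex_nsets_derived_lessThan unfolding S_def by blast
  from partition_nsets_derived[where e = e and \<zeta> = \<zeta> and k = k and c = c,
      OF \<nu>(1) e \<zeta> based assms(5) P]
  consider X F where "X \<subseteq> S" "homogeneous c Red X" "F \<in> [derived X \<nu>]\<^bsup>m\<^esup>"
    | "\<exists>Y\<in>[S]\<^bsup>(k + 2)\<^esup>. homogeneous c Blue Y"
    by blast
  then show "(\<exists>X\<subseteq>S. order_homeomorphic X {..<omega_pow \<nu> * ord_of_nat m + 1} \<and> homogeneous c Red X) \<or>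
    (\<exists>Y\<in>[S]\<^bsup>(k + 2)\<^esup>. homogeneous c Blue Y)"
  proof cases
    case 1
    then have "countable X"
      using S countable_subset by metis
    then obtain Y where "Y \<subseteq> X" "order_homeomorphic Y {..<omega_pow \<nu> * ord_of_nat m + 1}"
      using ex_closed_copy_successor \<nu> 1(3) assms(4) by metis
    then show ?thesis
      using 1 homogeneous_subset by (meson subset_trans)
  qed simp
qed

section \<open>Finite Ramsey numbers as values of \<open>R_ord\<close>\<close>

lemma bij_betw_ord_of_nat: "bij_betw ord_of_nat {..<n} {..<ord_of_nat n :: 'a::infinite ordinal}"
proof -
  have "inj (ord_of_nat :: nat \<Rightarrow> 'a ordinal)"
    by (rule strict_mono_imp_inj_on) (simp add: strict_mono_def ord_of_nat_strict_mono)
  moreover have "x \<in> ord_of_nat ` {..<n}" if x: "x < ord_of_nat n" for x :: "'a ordinal"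
  proof -
    obtain i where i: "x = ord_of_nat i"
      using less_trans[OF x ord_of_nat_less_omega] by (rule less_omegaE)
    then have "i < n"
      using x by (metis linorder_not_le ord_of_nat_le_iff)
    then show ?thesis
      using i by blast
  qed
  then have "ord_of_nat ` {..<n} = {..<ord_of_nat n :: 'a ordinal}"
    by (auto simp: ord_of_nat_strict_mono)
  ultimately show ?thesis
    using inj_on_subset[OF _ subset_UNIV] by (simp add: bij_betw_def)
qed

lemma order_isomorphic_ord_of_nat_iff:
  fixes X :: "'a::infinite ordinal set"
  assumes "finite X"
  shows "order_isomorphic X {..<ord_of_nat m} \<longleftrightarrow> card X = m"
proof -
  have card: "card {..<ord_of_nat n :: 'a ordinal} = n" for n
    using bij_betw_same_card[OF bij_betw_ord_of_nat[of n, where 'a = 'a]] by simp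
  show ?thesis
  proof
    assume "order_isomorphic X {..<ord_of_nat m}"
    then show "card X = m"
      unfolding order_isomorphic_def using bij_betw_same_card card by metis
  next
    assume m: "card X = m"
    \<comment> \<open>A finite set has no limit points, so the collapse applies; only its order part
      is used.\<close>
    have "\<forall>y\<in>X. \<forall>z<y. z islimpt X \<longrightarrow> z \<in> X"
      using islimpt_finite[OF assms] by blast
    from ex_order_homeomorphism[OF countable_finite[OF assms] this]
    obtain \<xi> :: "'a ordinal" and f g where f: "homeomorphism X {..<\<xi>} f g" "strict_mono_on X f"
      by blast
    then have bij: "bij_betw f X {..<\<xi>}"
      by (simp add: bij_betw_def homeomorphism_image1 strict_mono_on_imp_inj_on)
    then have fin: "finite {..<\<xi>}"
      using assms bij_betw_finite by blast
    have "\<xi> < \<omega>"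
    proof (rule ccontr)
      assume "\<not> \<xi> < \<omega>"
      then have "ord_of_nat (Suc (card {..<\<xi>})) \<le> \<xi>"
        using less_imp_le[OF ord_of_nat_less_omega] by (metis linorder_not_le order_trans)
      then have "{..<ord_of_nat (Suc (card {..<\<xi>}))} \<subseteq> {..<\<xi>}"
        by auto
      then show False
        using card_mono[OF fin] card by (metis Suc_n_not_le_n)
    qed
    then obtain n where n: "\<xi> = ord_of_nat n"
      by (rule less_omegaE)
    then have "n = m"
      using bij_betw_same_card[OF bij] card m by simp
    then show "order_isomorphic X {..<ord_of_nat m}"
      using f(2) bij n unfolding order_isomorphic_def by blast
  qed
qed

lemma arrows_ord_iff_finite_arrows:
  "arrows_ord (ord_of_nat M :: 'a::infinite ordinal) (ord_of_nat m) k \<longleftrightarrow> finite_arrows M m k"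
proof -
  define S where "S = {..<ord_of_nat M :: 'a ordinal}"
  have bij: "bij_betw ord_of_nat {..<M} S"
    unfolding S_def by (rule bij_betw_ord_of_nat)
  then have "finite S" "card S = M"
    using bij_betw_finite[OF bij] bij_betw_same_card[OF bij] by simp_all
  then have iso: "order_isomorphic X {..<ord_of_nat m} \<longleftrightarrow> X \<in> [S]\<^bsup>m\<^esup>" if "X \<subseteq> S" for X
    using that order_isomorphic_ord_of_nat_iff[of X m] finite_subset by (auto simp: nsets_def)
  have S: "arrows_ord (ord_of_nat M :: 'a ordinal) (ord_of_nat m) k \<longleftrightarrow>
      (\<forall>c. (\<exists>F\<in>[S]\<^bsup>m\<^esup>. homogeneous c Red F) \<or> (\<exists>Y\<in>[S]\<^bsup>k\<^esup>. homogeneous c Blue Y))"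
    unfolding arrows_def ball_nsets_2_iff S_def[symmetric]
    using iso by (metis (no_types, lifting) mem_Collect_eq nsets_def)
  show ?thesis
  proof
    assume "finite_arrows M m k"
    then show "arrows_ord (ord_of_nat M :: 'a ordinal) (ord_of_nat m) k"
      unfolding S using finite_arrowsD[of M m k S S] \<open>finite S\<close> \<open>card S = M\<close> by (simp add: nsets_def)
  next
    assume arrows: "arrows_ord (ord_of_nat M :: 'a ordinal) (ord_of_nat m) k"
    define h where "h = inv_into {..<M} (ord_of_nat :: nat \<Rightarrow> 'a ordinal)"
    have h: "inj_on h S" "h ` S = {..<M}"
      using bij_betw_inv_into[OF bij] by (auto simp: h_def bij_betw_def)
    have "h ` A \<in> [{..<M}]\<^bsup>n\<^esup> \<and> homogeneous c C (h ` A)"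
      if "A \<in> [S]\<^bsup>n\<^esup>" "homogeneous (\<lambda>e. c (h ` e)) C A" for A n c C
    proof -
      have "inj_on h A"
        using that(1) h(1) inj_on_subset by (auto simp: nsets_def)
      then show ?thesis
        using that h(2) by (auto simp: nsets_def card_image homogeneous_image)
    qed
    then show "finite_arrows M m k"
      using arrows unfolding finite_arrows_def S by meson
  qed
qed

lemma R_ord_ord_of_nat:
  obtains M where "R_ord (ord_of_nat m :: 'a::infinite ordinal) k = ord_of_nat M" "finite_arrows M m k"
proof -
  obtain N where "finite_arrows N m k"
    using ex_finite_arrows by blast
  then have N: "arrows_ord (ord_of_nat N :: 'a ordinal) (ord_of_nat m) k"
    by (simp add: arrows_ord_iff_finite_arrows)
  then have "R_ord (ord_of_nat m :: 'a ordinal) k \<le> ord_of_nat N"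
    unfolding R_ord_def by (rule Least_le)
  then have "R_ord (ord_of_nat m :: 'a ordinal) k < \<omega>"
    using ord_of_nat_less_omega by (rule le_less_trans)
  then obtain M where M: "R_ord (ord_of_nat m :: 'a ordinal) k = ord_of_nat M"
    by (rule less_omegaE)
  have "arrows_ord (R_ord (ord_of_nat m) k) (ord_of_nat m :: 'a ordinal) k"
    unfolding R_ord_def using N by (rule LeastI)
  then have "finite_arrows M m k"
    by (simp add: M arrows_ord_iff_finite_arrows)
  with M show thesis
    by (rule that)
qed

text \<open>From \<open>e j = omega_pow (tower_exponent \<alpha> j)\<close> and the least exponent
  \<open>tower_exponent \<alpha> j + 1\<close> whose power exceeds \<open>e j\<close>, the product
  with \<open>omega_pow \<alpha>\<close> gives the next exponent.\<close>

fun tower_exponent :: "'a ordinal \<Rightarrow> nat \<Rightarrow> 'a ordinal"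
  where
    "tower_exponent \<alpha> 0 = \<alpha>"
  | "tower_exponent \<alpha> (Suc j) = (tower_exponent \<alpha> j + 1) + \<alpha>"

lemma tower_exponent_infinite:
  fixes \<alpha> :: "'a::infinite ordinal"
  assumes "infinite {..<\<alpha>}"
  shows "tower_exponent \<alpha> j = \<alpha> * ord_of_nat (Suc j)"
  by (induction j) (simp_all add: plus_ordinal_assoc one_plus_infinite_ordinal[OF assms] times_plus_ordinal)

lemma tower_exponent_finite:
  "tower_exponent (ord_of_nat n :: 'a::infinite ordinal) j = ord_of_nat ((n + 1) * Suc j - 1)"
proof (induction j)
  case (Suc j)
  have "(n + 1) * Suc (Suc j) - 1 = ((n + 1) * Suc j - 1) + 1 + n"
    by simp
  then show ?case
    by (simp only: tower_exponent.simps Suc ord_of_nat_add) simp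
qed simp

lemma countable_lessThan_tower_exponent:
  fixes \<alpha> :: "'a::infinite ordinal"
  assumes "countable {..<\<alpha>}"
  shows "countable {..<tower_exponent \<alpha> j}"
proof (induction j)
  case (Suc j)
  have "countable {..<1 :: 'a ordinal}"
    using countable_lessThan_ord_of_nat[of 1, where 'a = 'a] by simp
  then show ?case
    using assms Suc by (simp add: countable_lessThan_plus_ordinal)
qed (simp add: assms)

lemma finite_arrows_one: "finite_arrows 1 1 k"
proof -
  have "{..<1} \<in> [{..<1 :: nat}]\<^bsup>1\<^esup>" "homogeneous c Red {..<1 :: nat}" for c
    by (auto simp: nsets_def homogeneous_def)
  then show ?thesis
    unfolding finite_arrows_def by blast
qed

lemma arrows_cl_tower_exponent:
  fixes \<alpha> :: "'a::infinite ordinal"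
  assumes "countable {..<\<alpha>}"
  shows "arrows_cl (omega_pow (omega_pow (tower_exponent \<alpha> j)) + 1) (omega_pow (omega_pow \<alpha>) + 1) (j + 2)"
proof -
  have pos: "0 < tower_exponent \<alpha> j + 1" for j
    by (simp add: less_plus_one_ordinal_iff)
  have less: "omega_pow (tower_exponent \<alpha> j) < omega_pow (tower_exponent \<alpha> j + 1)" for j
    by (simp add: omega_pow_strict_mono less_plus_one_ordinal_iff)
  have "arrows_cl (omega_pow (omega_pow (tower_exponent \<alpha> j)) * ord_of_nat 1 + 1)
    (omega_pow (omega_pow \<alpha>) * ord_of_nat 1 + 1) (j + 2)"
    by (rule arrows_cl_successor[where e = "\<lambda>j. omega_pow (tower_exponent \<alpha> j)"
          and \<zeta> = "\<lambda>j. tower_exponent \<alpha> j + 1", OF _ _ _ _ finite_arrows_one _ _ pos less])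
      (simp_all add: assms countable_lessThan_omega_pow countable_lessThan_tower_exponent
        omega_pow_plus)
  then show ?thesis
    by simp
qed

theorem corollary10p5:
  fixes \<alpha> :: "'a::infinite ordinal" and k m n :: nat
  assumes "countable {..<\<alpha>}" and "\<alpha> \<noteq> 0" and "k > 0" and "m > 0" and "n > 0"
  shows
    "((\<exists>\<beta>. arrows_cl \<beta> (omega_pow (omega_pow \<alpha>)) (k + 1)) \<and>
      R_top (omega_pow (omega_pow \<alpha>)) (k + 1) = R_cl (omega_pow (omega_pow \<alpha>)) (k + 1) \<and>
      R_cl (omega_pow (omega_pow \<alpha>)) (k + 1) \<le> omega_pow (omega_pow (\<alpha> * ord_of_nat k)))
    \<and>
     ((\<exists>\<beta>. arrows_cl \<beta> (omega_pow (omega_pow \<alpha>) + 1) (k + 1)) \<and>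
      R_top (omega_pow (omega_pow \<alpha>) + 1) (k + 1) = R_cl (omega_pow (omega_pow \<alpha>) + 1) (k + 1) \<and>
      (infinite {..<\<alpha>} \<longrightarrow>
        R_cl (omega_pow (omega_pow \<alpha>) + 1) (k + 1)
          \<le> omega_pow (omega_pow (\<alpha> * ord_of_nat k)) + 1) \<and>
      (\<alpha> = ord_of_nat n \<longrightarrow>
        R_cl (omega_pow (omega_pow \<alpha>) + 1) (k + 1)
          \<le> omega_pow (omega_pow (ord_of_nat ((n + 1) * k - 1))) + 1))
    \<and>
     ((\<exists>\<beta> :: 'a ordinal. arrows_cl \<beta> (omega_pow (ord_of_nat n) * ord_of_nat m + 1) (k + 2)) \<and>
      R_top (omega_pow (ord_of_nat n) * ord_of_nat m + 1 :: 'a ordinal) (k + 2)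
        = R_cl (omega_pow (ord_of_nat n) * ord_of_nat m + 1) (k + 2) \<and>
      R_cl (omega_pow (ord_of_nat n) * ord_of_nat m + 1 :: 'a ordinal) (k + 2)
        \<le> omega_pow (omega_pow (ord_of_nat k) * ord_of_nat n) * R_ord (ord_of_nat m) (k + 2) + 1)"
proof -
  have R_cl_le: "R_cl \<theta> l \<le> \<beta>" if "arrows_cl \<beta> \<theta> l" for \<theta> \<beta> :: "'a ordinal" and l
    unfolding R_cl_def using that by (rule Least_le)
  have "0 < \<alpha>"
    using assms(2) by (simp add: less_le)
  \<comment> \<open>The partition lemmas are indexed by blue sets of size \<open>j + 2\<close>,
    which is \<open>k + 1\<close> in the first two items and \<open>k + 2\<close> with
    \<open>j = k\<close> in the third.\<close>
  obtain j where k: "k = Suc j"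
    using assms(3) by (cases k) auto
  have limit: "arrows_cl (omega_pow (omega_pow (\<alpha> * ord_of_nat k))) (omega_pow (omega_pow \<alpha>)) (k + 1)"
    using arrows_cl_limit[OF assms(1) \<open>0 < \<alpha>\<close>, of j] by (simp add: k)
  have limit_eq: "R_top (omega_pow (omega_pow \<alpha>)) (k + 1) = R_cl (omega_pow (omega_pow \<alpha>)) (k + 1)"
    by (intro R_top_eq_R_cl_limit countable_lessThan_omega_pow limit_ordinal_omega_pow) fact+
  have tower: "arrows_cl (omega_pow (omega_pow (tower_exponent \<alpha> j)) + 1)
      (omega_pow (omega_pow \<alpha>) + 1) (k + 1)"
    using arrows_cl_tower_exponent[OF assms(1), of j] by (simp add: k)
  have tower_eq: "R_top (omega_pow (omega_pow \<alpha>) + 1) (k + 1) = R_cl (omega_pow (omega_pow \<alpha>) + 1) (k + 1)"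
    using R_top_eq_R_cl_successor[OF countable_lessThan_omega_pow[OF assms(1)] omega_pow_pos, of 1 "k + 1"]
    by simp
  have pos: "0 < (ord_of_nat n :: 'a ordinal)"
    using ord_of_nat_strict_mono[OF assms(5), where 'a = 'a] by simp
  obtain M where M: "R_ord (ord_of_nat m :: 'a ordinal) (k + 2) = ord_of_nat M" "finite_arrows M m (k + 2)"
    by (rule R_ord_ord_of_nat)
  \<comment> \<open>For finite \<open>\<nu>\<close>, \<open>omega_pow i * n\<close> is already below
    \<open>omega_pow (i + 1)\<close>, so the exponent grows by exactly 1 per blue point.\<close>
  define e :: "nat \<Rightarrow> 'a ordinal" where "e i = omega_pow (ord_of_nat i) * ord_of_nat n" for i
  have finite: "arrows_cl (omega_pow (e k) * ord_of_nat M + 1)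
      (omega_pow (ord_of_nat n) * ord_of_nat m + 1) (k + 2)"
  proof (rule arrows_cl_successor[where e = e and \<zeta> = "\<lambda>i. ord_of_nat (Suc i)"])
    show "countable {..<e k}"
      unfolding e_def by (intro countable_lessThan_times_ordinal countable_lessThan_omega_pow
          countable_lessThan_ord_of_nat)
    show "e i < omega_pow (ord_of_nat (Suc i))" for i
      using times_ordinal_ord_of_nat_less[of "ord_of_nat i" n] by (simp add: e_def omega_pow_plus_one)
    show "e 0 = ord_of_nat n"
      by (simp add: e_def one_times_ordinal)
    show "0 < (ord_of_nat (Suc i) :: 'a ordinal)" for i
      by (simp add: less_plus_one_ordinal_iff)
  qed (use M pos assms(4) in \<open>simp_all add: e_def countable_lessThan_ord_of_nat del: ord_of_nat.simps\<close>)
  have finite_eq: "R_top (omega_pow (ord_of_nat n) * ord_of_nat m + 1 :: 'a ordinal) (k + 2)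
      = R_cl (omega_pow (ord_of_nat n) * ord_of_nat m + 1) (k + 2)"
    by (intro R_top_eq_R_cl_successor countable_lessThan_ord_of_nat pos assms(4))
  show ?thesis
  proof (intro conjI impI)
    show "R_cl (omega_pow (omega_pow \<alpha>) + 1) (k + 1) \<le> omega_pow (omega_pow (\<alpha> * ord_of_nat k)) + 1"
      if "infinite {..<\<alpha>}"
      using R_cl_le[OF tower] by (simp only: tower_exponent_infinite[OF that] k)
    show "R_cl (omega_pow (omega_pow \<alpha>) + 1) (k + 1)
        \<le> omega_pow (omega_pow (ord_of_nat ((n + 1) * k - 1))) + 1" if "\<alpha> = ord_of_nat n"
      using R_cl_le[OF tower] unfolding that tower_exponent_finite k .
    show "R_cl (omega_pow (ord_of_nat n) * ord_of_nat m + 1 :: 'a ordinal) (k + 2)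
        \<le> omega_pow (omega_pow (ord_of_nat k) * ord_of_nat n) * R_ord (ord_of_nat m) (k + 2) + 1"
      using R_cl_le[OF finite] by (simp only: e_def M(1))
  qed (use limit limit_eq tower tower_eq finite finite_eq R_cl_le in blast)+
qed

end
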